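(* Let $q=2^m$ with $m\ge 1$ an integer, and let $\mathcal{L}$ denote the Lie algebra of all $q\times q$ complex matrices of trace $0$. Then there is a decomposition \[ \mathcal{L}=\mathcal{H}_1\perp\cdots\perp\mathcal{H}_{q+1} \] of $\mathcal{L}$ into a direct sum (as vector spaces) of $q+1$ Cartan subalgebras $\mathcal{H}_i$, which are pairwise orthogonal with respect to the Killing form of $\mathcal{L}$, and which are transitively permuted by an automorphism of the Lie algebra $\mathcal{L}$ of order $q+1$ (that is, there is an automorphism of order $q+1$ such that the cyclic group it generates permutes the set $\{\mathcal{H}_1,\dots,\mathcal{H}_{q+1}\}$ transitively).
   Context: The symbol $\perp$ denotes a vector space direct sum whose summands are pairwise orthogonal with respect to the Killing form. *)

theory Defs
  imports
    "HOL-Analysis.Analysis"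
    "HOL-Algebra.Bij"
    "HOL-Algebra.Elementary_Groups"
    "HOL-Algebra.Group_Action"
    "HOL-Algebra.Multiplicative_Group"
begin

locale lie_algebra = vector_space scale
  for scale :: "'k::field \<Rightarrow> 'v::ab_group_add \<Rightarrow> 'v" +
  fixes L :: "'v set"
    and brk :: "'v \<Rightarrow> 'v \<Rightarrow> 'v"
  assumes subspace_L: "subspace L"
    and brk_closed: "\<lbrakk>x \<in> L; y \<in> L\<rbrakk> \<Longrightarrow> brk x y \<in> L"
    and brk_add_left: "\<lbrakk>x \<in> L; y \<in> L; z \<in> L\<rbrakk> \<Longrightarrow> brk (x + y) z = brk x z + brk y z"
    and brk_add_right: "\<lbrakk>x \<in> L; y \<in> L; z \<in> L\<rbrakk> \<Longrightarrow> brk x (y + z) = brk x y + brk x z"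
    and brk_scale_left: "\<lbrakk>x \<in> L; y \<in> L\<rbrakk> \<Longrightarrow> brk (scale c x) y = scale c (brk x y)"
    and brk_scale_right: "\<lbrakk>x \<in> L; y \<in> L\<rbrakk> \<Longrightarrow> brk x (scale c y) = scale c (brk x y)"
    and brk_self: "x \<in> L \<Longrightarrow> brk x x = 0"
    and jacobi: "\<lbrakk>x \<in> L; y \<in> L; z \<in> L\<rbrakk> \<Longrightarrow>
      brk x (brk y z) + brk y (brk z x) + brk z (brk x y) = 0"
begin

definition lie_subalgebra :: "'v set \<Rightarrow> bool" where
  "lie_subalgebra H \<longleftrightarrow>
     subspace H \<and> H \<subseteq> L \<and> (\<forall>x\<in>H. \<forall>y\<in>H. brk x y \<in> H)"

primrec lower_central :: "'v set \<Rightarrow> nat \<Rightarrow> 'v set" where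
  "lower_central H 0 = H"
| "lower_central H (Suc k) = span {brk x y | x y. x \<in> H \<and> y \<in> lower_central H k}"

definition nilpotent_subalgebra :: "'v set \<Rightarrow> bool" where
  "nilpotent_subalgebra H \<longleftrightarrow> lie_subalgebra H \<and> (\<exists>k. lower_central H k = {0})"

definition normalizer :: "'v set \<Rightarrow> 'v set" where
  "normalizer H = {x \<in> L. \<forall>h\<in>H. brk x h \<in> H}"

definition cartan_subalgebra :: "'v set \<Rightarrow> bool" where
  "cartan_subalgebra H \<longleftrightarrow> nilpotent_subalgebra H \<and> normalizer H = H"

text \<open>The trace of the endomorphism of the subspace \<open>V\<close> that \<open>f\<close> restricts to, read off from
  the diagonal of its matrix in an arbitrary basis of \<open>V\<close>; it is meant for finite-dimensional
  \<open>V\<close> with \<open>f ` V \<subseteq> V\<close>, and then does not depend on the basis.\<close>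

definition endo_trace :: "'v set \<Rightarrow> ('v \<Rightarrow> 'v) \<Rightarrow> 'k" where
  "endo_trace V f =
     (let B = (SOME B. independent B \<and> span B = V) in \<Sum>b\<in>B. representation B (f b) b)"

definition killing_form :: "'v \<Rightarrow> 'v \<Rightarrow> 'k" where
  "killing_form x y = endo_trace L (brk x \<circ> brk y)"

definition lie_auts :: "('v \<Rightarrow> 'v) set" where
  "lie_auts =
     {f \<in> Bij L.
        (\<forall>x\<in>L. \<forall>y\<in>L. f (x + y) = f x + f y) \<and>
        (\<forall>c. \<forall>x\<in>L. f (scale c x) = scale c (f x)) \<and>
        (\<forall>x\<in>L. \<forall>y\<in>L. f (brk x y) = brk (f x) (f y))}"

definition lie_aut_group :: "('v \<Rightarrow> 'v) monoid" where
  "lie_aut_group = BijGroup L \<lparr>carrier := lie_auts\<rparr>"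

definition direct_sum_decomp :: "'i set \<Rightarrow> ('i \<Rightarrow> 'v set) \<Rightarrow> bool" where
  "direct_sum_decomp I H \<longleftrightarrow>
     finite I \<and> (\<forall>i\<in>I. subspace (H i)) \<and>
     bij_betw (\<lambda>h. \<Sum>i\<in>I. h i) (\<Pi>\<^sub>E i\<in>I. H i) L"

definition killing_orthogonal :: "'v set \<Rightarrow> 'v set \<Rightarrow> bool" where
  "killing_orthogonal U W \<longleftrightarrow> (\<forall>x\<in>U. \<forall>y\<in>W. killing_form x y = 0)"

lemma subgroup_lie_auts: "subgroup lie_auts (BijGroup L)"
proof (rule group.subgroupI[OF group_BijGroup])
  show "lie_auts \<subseteq> carrier (BijGroup L)"
    by (auto simp: lie_auts_def BijGroup_def)
  have "(\<lambda>x\<in>L. x) \<in> lie_auts"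
    by (auto simp: lie_auts_def id_Bij subspace_L subspace_add subspace_scale brk_closed)
  then show "lie_auts \<noteq> {}" by blast
next
  fix f g assume f: "f \<in> lie_auts" and g: "g \<in> lie_auts"
  then have "f \<in> Bij L" "g \<in> Bij L" by (auto simp: lie_auts_def)
  moreover from this have "\<And>x. x \<in> L \<Longrightarrow> g x \<in> L"
    using Bij_imp_funcset by blast
  ultimately show "f \<otimes>\<^bsub>BijGroup L\<^esub> g \<in> lie_auts"
    using f g
    by (auto simp: lie_auts_def BijGroup_def compose_Bij compose_eq
        subspace_add[OF subspace_L] subspace_scale[OF subspace_L] brk_closed)
next
  fix f assume f: "f \<in> lie_auts"
  then have fB: "f \<in> Bij L" by (auto simp: lie_auts_def)
  then have bij: "bij_betw f L L" by (auto simp: Bij_def)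
  let ?g = "inv_into L f"
  have g: "?g x \<in> L" "f (?g x) = x" if "x \<in> L" for x
    using bij that by (auto simp: Bij_inv_into_mem fB bij_betw_inv_into_right)
  have gI: "?g y = x" if "x \<in> L" "f x = y" for x y
    using bij that by (auto simp: bij_betw_inv_into_left)
  have "?g (x + y) = ?g x + ?g y" if "x \<in> L" "y \<in> L" for x y
    using f g that by (intro gI) (auto simp: lie_auts_def subspace_add[OF subspace_L])
  moreover have "?g (scale c x) = scale c (?g x)" if "x \<in> L" for c x
    using f g that by (intro gI) (auto simp: lie_auts_def subspace_scale[OF subspace_L])
  moreover have "?g (brk x y) = brk (?g x) (?g y)" if "x \<in> L" "y \<in> L" for x y
    using f g that by (intro gI) (auto simp: lie_auts_def brk_closed)
  ultimately have "(\<lambda>x\<in>L. ?g x) \<in> lie_auts"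
    by (auto simp: lie_auts_def restrict_inv_into_Bij[OF fB] brk_closed
        subspace_add[OF subspace_L] subspace_scale[OF subspace_L])
  then show "inv\<^bsub>BijGroup L\<^esub> f \<in> lie_auts"
    by (simp add: inv_BijGroup[OF fB])
qed

lemma group_lie_aut_group: "group lie_aut_group"
  unfolding lie_aut_group_def
  by (rule subgroup.subgroup_is_group[OF subgroup_lie_auts group_BijGroup])

end

definition mat_scale :: "complex \<Rightarrow> complex^'n^'n \<Rightarrow> complex^'n^'n" where
  "mat_scale c A = (\<chi> i j. c * A $ i $ j)"

definition commutator :: "complex^'n^'n \<Rightarrow> complex^'n^'n \<Rightarrow> complex^'n^'n" where
  "commutator A B = A ** B - B ** A"

definition sl :: "(complex^'n^'n) set" where
  "sl = {A. trace A = 0}"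

lemma mat_scale_mult:
  "mat_scale c A ** B = mat_scale c (A ** B)"
  "A ** mat_scale c B = mat_scale c (A ** B)"
  by (simp_all add: mat_scale_def matrix_matrix_mult_def vec_eq_iff sum_distrib_left mult_ac)

interpretation mat_space: vector_space mat_scale
  by unfold_locales (simp_all add: mat_scale_def vec_eq_iff algebra_simps)

lemma matrix_mult_add_diff:
  fixes A B C :: "complex^'n^'n"
  shows "(A + B) ** C = A ** C + B ** C" "C ** (A + B) = C ** A + C ** B"
    "(A - B) ** C = A ** C - B ** C" "C ** (A - B) = C ** A - C ** B"
  by (simp_all add: matrix_matrix_mult_def vec_eq_iff algebra_simps sum_subtractf sum.distrib)

interpretation sl: lie_algebra mat_scale "sl :: (complex^'n^'n) set" commutator
proof
  show "mat_space.subspace (sl :: (complex^'n^'n) set)"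
    by (auto simp: mat_space.subspace_def sl_def trace_def mat_scale_def sum.distrib
        simp flip: sum_distrib_left)
next
  fix A B :: "complex^'n^'n"
  show "commutator A B \<in> sl"
    using trace_mul_sym[of A B] by (simp add: sl_def commutator_def trace_sub)
qed (simp_all add: commutator_def mat_scale_mult mat_space.scale_right_diff_distrib
    matrix_mult_add_diff matrix_mul_assoc)

end

(* Let K be the field of order q^2, F its subfield of order q, psi a nontrivial additive character of F
   with values 1 and -1, tr the trace from K to F, and gamma in K with gamma^q = gamma + 1. The sign
   eps(w, v) = psi(tr(gamma w v^q)) is bimultiplicative on K and invariant under multiplication by
   any xi in K with xi^(q+1) = 1. Rescaling the Weyl matrices by fourth roots of unity gives a basis
   P_w (w in K) of the q x q matrices with P_w P_v = eps(w, v) P_{w+v}, so P_w -> P_{xi w} extends to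
   an algebra automorphism, of order q + 1 when xi has order q + 1. The q + 1 lines of the F-plane K
   are maximal isotropic for the commutator pairing eps(w, v) eps(v, w). They partition K - {0}, and
   multiplication by xi permutes them cyclically (here 2 is invertible modulo q + 1); the P_w with w
   nonzero in a line span a Cartan subalgebra. Different lines are Killing-orthogonal because
   ad P_w ad P_v maps P_u to a multiple of P_{u+v+w}, hence has zero diagonal when w and v differ. *)

theory Submission
  imports Defs "HOL-Algebra.Algebraic_Closure_Type" "HOL-Library.Z2"
begin

(* HOL-Algebra reserves X for the polynomial variable. *)
no_notation Polynomials.var ("X\<index>")

text \<open>The familiar matrices, shifts times diagonal characters, have the cocycle
  \<open>eps0\<close>, and that one is not invariant under \<open>\<xi>\<close>:
  \<open>eps0 w w\<close> is 1 on the line F, whose images under the powers of \<open>\<xi>\<close>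
  fill K, but it is not 1 throughout K. For odd q, half of the symplectic form would be an invariant
  exponent. Here 2 is not invertible, and \<open>\<gamma>\<close> takes the role of one half,
  because its conjugate sum gamma + gamma^q is 1. The form tr(gamma w v^q) involves w and v only
  through w v^q, which norm-one factors leave alone, and it polarizes to the same symplectic form w
  v^q + v w^q that belongs to \<open>eps0\<close>. Two cocycles with one commutator pairing differ
  by a symmetric one, and a symmetric bimultiplicative sign on an elementary abelian 2-group becomes
  a coboundary over the complex numbers; square roots of -1 enter there. After this correction the
  permutation of the basis needs no scalar factors, so the order of the automorphism is simply that
  of multiplication by \<open>\<xi>\<close>.\<close>

subsection \<open>Finite fields of characteristic two\<close>

type_synonym F2bar = "bit alg_closure"

lemma two_eq_0_F2bar: "(2 :: F2bar) = 0"
proof -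
  have "(2 :: F2bar) = to_ac (1 + 1 :: bit)" by (simp only: one_add_one to_ac_numeral)
  also have "(1 + 1 :: bit) = 0" by simp
  finally show ?thesis by simp
qed

lemma add_self_F2bar [simp]: "x + x = (0 :: F2bar)"
  by (metis mult_2 mult_zero_left two_eq_0_F2bar)

lemma add_self_left_F2bar [simp]: "x + (x + y) = (y :: F2bar)"
  by (metis add.assoc add_0 add_self_F2bar)

lemma uminus_F2bar [simp]: "- x = (x :: F2bar)"
  by (metis add_self_F2bar minus_unique)

lemma diff_F2bar [simp]: "x - y = (x + y :: F2bar)"
  by (metis diff_conv_add_uminus uminus_F2bar)

lemma add_eq_0_F2bar: "x + y = 0 \<longleftrightarrow> x = (y :: F2bar)"
  by (metis add_self_F2bar add_self_left_F2bar add.right_neutral)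

lemma frobenius_add: "(x + y :: F2bar) ^ 2 ^ n = x ^ 2 ^ n + y ^ 2 ^ n"
proof (induction n)
  case (Suc n)
  have "(a + b)\<^sup>2 = a\<^sup>2 + b\<^sup>2" for a b :: F2bar
    by (simp add: power2_sum two_eq_0_F2bar)
  then show ?case
    using Suc by (simp add: power_mult mult.commute[of 2])
qed simp

lemma frobenius_sum: "(\<Sum>i\<in>A. f i :: F2bar) ^ 2 ^ n = (\<Sum>i\<in>A. f i ^ 2 ^ n)"
  by (induction A rule: infinite_finite_induct) (simp_all add: frobenius_add)

text \<open>Both fields are fixed sets of Frobenius powers in one algebraic closure, so the
  extension is an inclusion of sets and the roots of unity live in the same type. At
  \<open>n = 0\<close> the set is the whole closure, hence the hypotheses \<open>n > 0\<close>
  below.\<close>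

definition GF2 :: "nat \<Rightarrow> F2bar set" where
  "GF2 n = {x. x ^ 2 ^ n = x}"

lemma GF2_closed [simp]:
  "0 \<in> GF2 n" "1 \<in> GF2 n"
  "x \<in> GF2 n \<Longrightarrow> y \<in> GF2 n \<Longrightarrow> x + y \<in> GF2 n"
  "x \<in> GF2 n \<Longrightarrow> y \<in> GF2 n \<Longrightarrow> x * y \<in> GF2 n"
  "x \<in> GF2 n \<Longrightarrow> inverse x \<in> GF2 n"
  "x \<in> GF2 n \<Longrightarrow> x ^ k \<in> GF2 n"
  by (simp_all add: GF2_def frobenius_add power_mult_distrib power_inverse)
    (metis power_mult mult.commute)

text \<open>X^(2^n) + X splits, and its derivative is the constant 1. A repeated root would be a
  root of the derivative, so there are as many roots as the degree.\<close>

lemma finite_card_GF2: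
  assumes "n > 0"
  shows "finite (GF2 n)" "card (GF2 n) = 2 ^ n"
proof -
  define p :: "F2bar poly" where "p = Polynomial.monom 1 (2 ^ n) + Polynomial.monom 1 1"
  have n: "(2::nat) ^ n > 1" using assms by (intro one_less_power) simp_all
  have deg: "Polynomial.degree p = 2 ^ n"
    unfolding p_def using n by (subst degree_add_eq_left) (simp_all add: degree_monom_eq)
  then have p0: "p \<noteq> 0" using n by force
  have poly_p: "poly p x = x ^ 2 ^ n + x" for x
    by (simp add: p_def poly_monom)
  have roots: "GF2 n = {x. poly p x = 0}"
    by (auto simp: GF2_def poly_p add_eq_0_F2bar)
  then show fin: "finite (GF2 n)" using p0 poly_roots_finite by simp
  have pderiv: "pderiv p = 1"
    using assms two_eq_0_F2bar
    by (simp add: p_def pderiv_add pderiv_monom power_0_left)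
  obtain A where A: "size A = Polynomial.degree p" "p = Polynomial.smult (Polynomial.lead_coeff p) (\<Prod>x\<in>#A. [:-x, 1:])"
    using alg_closed_imp_factorization[OF p0] by blast
  have set_A: "set_mset A = {x. poly p x = 0}"
  proof -
    have "poly p x = Polynomial.lead_coeff p * prod_mset (image_mset ((+) x) A)" for x
      by (subst A(2)) (simp add: poly_prod_mset image_mset.compositionality o_def add.commute[of _ x])
    then show ?thesis using p0 by (auto simp: prod_mset_zero_iff add_eq_0_F2bar)
  qed
  have "count A a = 1" if a: "a \<in># A" for a
  proof (rule ccontr)
    assume "count A a \<noteq> 1"
    with a have "count A a \<ge> 2" by (simp add: count_greater_zero_iff[symmetric] del: count_greater_zero_iff)
    obtain A' where A': "A = add_mset a A'" using a by (metis multi_member_split)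
    with \<open>count A a \<ge> 2\<close> have "a \<in># A'" by (simp flip: count_greater_zero_iff)
    then obtain B where B: "A = add_mset a (add_mset a B)" using A' by (metis multi_member_split)
    \<comment> \<open>The leading coefficient is moved inward past both factors X - a, so that the
      product rule visibly leaves a factor X - a in every summand.\<close>
    note r = A(2)[unfolded B image_mset_add_mset prod_mset.add_mset mult_smult_right[symmetric]]
    have "poly (pderiv p) a = 0"
      by (subst r) (simp add: pderiv_mult pderiv_smult del: mult_pCons_left mult_pCons_right)
    then show False by (simp add: pderiv)
  qed
  then have "size A = card (set_mset A)"
    by (simp add: size_multiset_overloaded_eq)
  then show "card (GF2 n) = 2 ^ n" using A(1) deg roots set_A by simp
qed

lemma GF2_double: "x \<in> GF2 m \<Longrightarrow> x \<in> GF2 (2 * m)"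
  by (simp add: GF2_def power_add power_mult mult_2)

lemma GF2_gen:
  assumes "n > 0"
  shows "\<exists>g. \<forall>x. x \<in> GF2 n \<and> x \<noteq> 0 \<longleftrightarrow> (\<exists>k::nat. x = g ^ k)"
proof -
  let ?R = "\<lparr>carrier = GF2 n, monoid.mult = (*), one = 1, ring.zero = 0, add = (+)\<rparr> :: F2bar ring"
  have inv: "\<exists>y\<in>GF2 n. x * y = 1" if "x \<in> GF2 n" "x \<noteq> 0" for x
    using that by (intro bexI[of _ "inverse x"]) auto
  interpret R: Ring.field ?R
    by unfold_locales
      (use inv in \<open>auto simp: algebra_simps Units_def intro: exI[of _ "_ :: F2bar"] add_self_F2bar\<close>)
  have pow: "x [^]\<^bsub>?R\<^esub> k = x ^ k" for x and k :: nat
    by (induction k) (simp_all add: nat_pow_def mult.commute)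
  from R.finite_field_mult_group_has_gen finite_card_GF2(1)[OF assms]
  obtain g where "GF2 n - {0} = {g [^]\<^bsub>?R\<^esub> k | k::nat. k \<in> UNIV}"
    by (auto)
  then show ?thesis unfolding pow by blast
qed

text \<open>Every solution of z^(q+1) = 1 satisfies z^(q^2 - 1) = 1 and so lies in
  \<open>GF2 (2 * m)\<close>; the solutions are the powers of g^(q-1) for a generator g of the
  multiplicative group there.\<close>

lemma cyclic_norm_one:
  assumes m: "m > 0"
  shows "\<exists>\<zeta> :: F2bar. (\<forall>z. z ^ (2 ^ m + 1) = 1 \<longleftrightarrow> (\<exists>k::nat. z = \<zeta> ^ k)) \<and>
    (\<forall>n. \<zeta> ^ n = 1 \<longleftrightarrow> (2 ^ m + 1) dvd n)"
proof -
  define q :: nat where "q = 2 ^ m"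
  define M where "M = (q - 1) * (q + 1)"
  have q: "q > 1" unfolding q_def using m by (intro one_less_power) simp_all
  have M0: "M > 0" using q by (simp add: M_def)
  obtain k where k: "q = Suc k" using q by (cases q) auto
  have "2 ^ (2 * m) = q * q" by (simp add: q_def mult_2 power_add)
  then have MSuc: "2 ^ (2 * m) = Suc M" by (simp add: M_def k)
  obtain g :: F2bar where g: "\<And>x. x \<in> GF2 (2 * m) \<and> x \<noteq> 0 \<longleftrightarrow> (\<exists>k::nat. x = g ^ k)"
    using GF2_gen[of "2 * m"] m by auto
  have gK: "g \<in> GF2 (2 * m)" "g \<noteq> 0" using g[of g] by (metis power_one_right)+
  have gM: "g ^ M = 1" using gK by (simp add: GF2_def MSuc)
  \<comment> \<open>If g^n = 1, exponents below n already give all M nonzero elements of the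
    field.\<close>
  have M_le: "M \<le> n" if "g ^ n = 1" "n > 0" for n
  proof -
    have "GF2 (2 * m) - {0} \<subseteq> (\<lambda>k. g ^ k) ` {..<n}"
    proof
      fix x assume "x \<in> GF2 (2 * m) - {0}"
      then obtain k where k: "x = g ^ k" using g[of x] by auto
      have "g ^ k = g ^ (n * (k div n) + k mod n)" by simp
      also have "\<dots> = g ^ (k mod n)" using that by (simp only: power_add power_mult) simp
      finally show "x \<in> (\<lambda>k. g ^ k) ` {..<n}" using k that by auto
    qed
    then have "card (GF2 (2 * m) - {0}) \<le> n"
      by (metis card_image_le card_lessThan card_mono finite_imageI finite_lessThan le_trans)
    then show ?thesis
      using finite_card_GF2[of "2 * m"] m MSuc by simp
  qed
  have g_ord: "g ^ n = 1 \<longleftrightarrow> M dvd n" for n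
  proof
    assume n: "g ^ n = 1"
    have "g ^ n = g ^ (M * (n div M) + n mod M)" by simp
    also have "\<dots> = g ^ (n mod M)" using gM by (simp only: power_add power_mult) simp
    finally have "g ^ (n mod M) = 1" using n by simp
    then have "n mod M = 0" using M_le[of "n mod M"] mod_less_divisor[OF M0, of n] by linarith
    then show "M dvd n" by auto
  next
    assume "M dvd n" then show "g ^ n = 1" using gM by (auto simp: power_mult)
  qed
  let ?\<zeta> = "g ^ (q - 1)"
  have ord: "?\<zeta> ^ n = 1 \<longleftrightarrow> (q + 1) dvd n" for n
    unfolding power_mult[symmetric] g_ord M_def using q by (intro nat_mult_dvd_cancel1) simp
  have "z ^ (q + 1) = 1 \<longleftrightarrow> (\<exists>k::nat. z = ?\<zeta> ^ k)" for z
  proof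
    assume z: "z ^ (q + 1) = 1"
    have "z ^ M = (z ^ (q + 1)) ^ (q - 1)" by (simp only: M_def mult.commute flip: power_mult)
    then have "z ^ M = 1" using z by simp
    then have "z \<in> GF2 (2 * m)" by (simp add: GF2_def MSuc)
    moreover have "z \<noteq> 0" using z by auto
    ultimately obtain k where k: "z = g ^ k" using g by blast
    then have "g ^ (k * (q + 1)) = 1" using z by (simp only: power_mult)
    then have "(q - 1) dvd k" unfolding g_ord M_def by (subst (asm) dvd_times_right_cancel_iff) simp_all
    then obtain j where "k = (q - 1) * j" ..
    then show "\<exists>k. z = ?\<zeta> ^ k" using k by (simp only: power_mult) blast
  next
    assume "\<exists>k. z = ?\<zeta> ^ k"
    then obtain k where "z = ?\<zeta> ^ k" by blast
    then have "z ^ (q + 1) = (?\<zeta> ^ (q + 1)) ^ k" by (simp only: mult_ac flip: power_mult)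
    then show "z ^ (q + 1) = 1" using ord[of "q + 1"] by simp
  qed
  with ord show ?thesis unfolding q_def by blast
qed

text \<open>Supplies an element of relative trace 1 over \<open>GF2 m\<close>; that it lies in the
  quadratic extension follows from the equation itself.\<close>

lemma artin_schreier_root: "\<exists>\<gamma> :: F2bar. \<gamma> ^ 2 ^ m = \<gamma> + 1" if "m > 0"
proof -
  define p :: "F2bar poly" where "p = Polynomial.monom 1 (2 ^ m) + (Polynomial.monom 1 1 + 1)"
  have n: "(2::nat) ^ m > 1" using that by (intro one_less_power) simp_all
  have "Polynomial.degree (Polynomial.monom 1 1 + 1 :: F2bar poly) \<le> 1"
    by (intro degree_add_le) (simp_all add: degree_monom_eq)
  then have "Polynomial.degree p = 2 ^ m"
    unfolding p_def using n by (subst degree_add_eq_left) (simp_all add: degree_monom_eq)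
  then obtain x where "poly p x = 0" using alg_closed_imp_poly_has_root[of p] by auto
  then have "x ^ 2 ^ m + (x + 1) = 0" by (simp add: p_def poly_monom)
  then show ?thesis by (auto simp: add_eq_0_F2bar)
qed

subsection \<open>Additive characters\<close>

text \<open>On \<open>GF2 m\<close> this is the trace to the prime field.\<close>

definition abs_trace :: "nat \<Rightarrow> F2bar \<Rightarrow> F2bar" where
  "abs_trace m x = (\<Sum>i<m. x ^ 2 ^ i)"

lemma abs_trace_add: "abs_trace m (x + y) = abs_trace m x + abs_trace m y"
  by (simp add: abs_trace_def frobenius_add sum.distrib)

text \<open>Squaring shifts the summands by one place, and x^(2^m) = x closes the cycle, so the
  trace is its own square.\<close>

lemma abs_trace_0_1:
  assumes "x \<in> GF2 m"
  shows "abs_trace m x = 0 \<or> abs_trace m x = 1"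
proof -
  let ?t = "abs_trace m x"
  have "?t ^ 2 ^ 1 = (\<Sum>i<m. x ^ 2 ^ Suc i)"
    unfolding abs_trace_def frobenius_sum by (simp flip: power_mult add: mult.commute)
  also have "\<dots> + x = (\<Sum>i<Suc m. x ^ 2 ^ i)"
    by (subst sum.lessThan_Suc_shift) (simp add: add.commute)
  also have "\<dots> = ?t + x" using assms by (simp add: abs_trace_def GF2_def)
  finally have "?t * ?t = ?t" by (simp add: power2_eq_square)
  then show ?thesis by simp
qed

text \<open>The trace is a polynomial of degree at most 2^(m-1) with linear coefficient 1, too small
  a degree to vanish on all 2^m elements.\<close>

lemma abs_trace_nonzero:
  assumes "m > 0"
  shows "\<exists>x\<in>GF2 m. abs_trace m x \<noteq> 0"
proof (rule ccontr)
  assume *: "\<not> ?thesis"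
  define p :: "F2bar poly" where "p = (\<Sum>i<m. Polynomial.monom 1 (2 ^ i))"
  have "Polynomial.coeff p 1 = (\<Sum>i<m. if i = 0 then 1 else 0)"
    unfolding p_def coeff_sum by (intro sum.cong) auto
  then have "Polynomial.coeff p 1 = 1" using assms by simp
  then have p: "p \<noteq> 0" by auto
  have "Polynomial.degree p \<le> 2 ^ (m - 1)"
    unfolding p_def by (intro degree_sum_le) (auto simp: degree_monom_eq)
  also have "\<dots> < (2::nat) ^ m" using assms by (intro power_strict_increasing) auto
  finally have deg: "Polynomial.degree p < 2 ^ m" .
  have "poly p x = abs_trace m x" for x
    by (simp add: p_def abs_trace_def poly_sum poly_monom)
  then have "GF2 m \<subseteq> {x. poly p x = 0}" using * by auto
  then have "card (GF2 m) \<le> card {x. poly p x = 0}"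
    using poly_roots_finite[OF p] by (intro card_mono)
  then show False using card_poly_roots_bound[OF p] deg finite_card_GF2[OF assms] by simp
qed

text \<open>Outside \<open>GF2 m\<close> the trace can take further values, all sent to -1. Thus
  being nonzero and squaring to 1 hold everywhere, multiplicativity only inside
  \<open>GF2 m\<close>.\<close>

definition sign_char :: "nat \<Rightarrow> F2bar \<Rightarrow> complex" where
  "sign_char m x = (if abs_trace m x = 0 then 1 else -1)"

lemma sign_char_0 [simp]: "sign_char m 0 = 1"
  by (simp add: sign_char_def abs_trace_def power_0_left)

lemma sign_char_nz [simp]: "sign_char m x \<noteq> 0"
  by (simp add: sign_char_def)

lemma sign_char_square [simp]: "sign_char m x * sign_char m x = 1"
  by (simp add: sign_char_def)

lemma sign_char_add:
  assumes "x \<in> GF2 m" "y \<in> GF2 m"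
  shows "sign_char m (x + y) = sign_char m x * sign_char m y"
  using abs_trace_0_1[OF assms(1)] abs_trace_0_1[OF assms(2)]
  by (auto simp: sign_char_def abs_trace_add)

lemma sign_char_nontrivial:
  assumes "m > 0" "a \<in> GF2 m" "a \<noteq> 0"
  shows "\<exists>x\<in>GF2 m. sign_char m (a * x) = -1"
proof -
  obtain y where y: "y \<in> GF2 m" "abs_trace m y \<noteq> 0" using abs_trace_nonzero[OF assms(1)] by blast
  show ?thesis
    using y assms by (intro bexI[of _ "inverse a * y"]) (auto simp: sign_char_def simp flip: mult.assoc)
qed

text \<open>Orthogonality of characters: translation by an element of sign -1 permutes the field and
  negates the sum.\<close>

lemma sum_sign_char:
  assumes "m > 0" "a \<in> GF2 m"
  shows "(\<Sum>x\<in>GF2 m. sign_char m (a * x)) = (if a = 0 then 2 ^ m else 0)"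
proof (cases "a = 0")
  case True
  then show ?thesis using finite_card_GF2[OF assms(1)] by simp
next
  case False
  then obtain y where y: "y \<in> GF2 m" "sign_char m (a * y) = -1"
    using sign_char_nontrivial assms by blast
  have "bij_betw (\<lambda>x. y + x) (GF2 m) (GF2 m)"
    using y by (intro bij_betwI[of _ _ _ "\<lambda>x. y + x"]) auto
  then have "(\<Sum>x\<in>GF2 m. sign_char m (a * x)) = (\<Sum>x\<in>GF2 m. sign_char m (a * (y + x)))"
    by (rule sum.reindex_bij_betw[symmetric])
  also have "\<dots> = - (\<Sum>x\<in>GF2 m. sign_char m (a * x))"
    using y assms by (simp add: distrib_left sign_char_add flip: sum_negf)
  finally show ?thesis using False by simp
qed

text \<open>A maximal subgroup \<open>U\<close> carrying a refinement is everything: on a coset \<open>s + U\<close> the value at \<open>s\<close>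
  only has to satisfy \<open>t(s)\<^sup>2 = c(s, s)\<close>, which forces fourth roots of unity.\<close>

lemma quadratic_refinement:
  fixes K :: "'g::ab_group_add set" and c :: "'g \<Rightarrow> 'g \<Rightarrow> complex"
  assumes fin: "finite K" and zero: "0 \<in> K"
    and add: "\<And>w v. w \<in> K \<Longrightarrow> v \<in> K \<Longrightarrow> w + v \<in> K"
    and self: "\<And>w. w \<in> K \<Longrightarrow> w + w = 0"
    and c_nz: "\<And>w v. w \<in> K \<Longrightarrow> v \<in> K \<Longrightarrow> c w v \<noteq> 0"
    and c_add: "\<And>w v u. w \<in> K \<Longrightarrow> v \<in> K \<Longrightarrow> u \<in> K \<Longrightarrow> c (w + v) u = c w u * c v u"
    and c_sym: "\<And>w v. w \<in> K \<Longrightarrow> v \<in> K \<Longrightarrow> c w v = c v w"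
  shows "\<exists>t. (\<forall>w\<in>K. t w \<noteq> 0) \<and> (\<forall>w\<in>K. \<forall>v\<in>K. t (w + v) = t w * t v * c w v)"
proof -
  have c0: "c 0 u = 1" if "u \<in> K" for u
    using c_add[OF zero zero that] c_nz[OF zero that] by simp
  have c_sq: "c w u * c w u = 1" if "w \<in> K" "u \<in> K" for w u
    using c_add[OF that(1) that] c0[OF that(2)] self[OF that(1)] by simp
  define S where "S = {U. U \<subseteq> K \<and> 0 \<in> U \<and> (\<forall>w\<in>U. \<forall>v\<in>U. w + v \<in> U) \<and>
    (\<exists>t. (\<forall>w\<in>U. t w \<noteq> 0) \<and> (\<forall>w\<in>U. \<forall>v\<in>U. t (w + v) = t w * t v * c w v))}"
  have "{0} \<in> S" using zero c0[OF zero] by (auto simp: S_def intro!: exI[of _ "\<lambda>_. 1"])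
  moreover have "finite S"
    using fin by (rule_tac finite_subset[of _ "Pow K"]) (auto simp: S_def)
  ultimately obtain U where U: "U \<in> S" and max: "\<And>V. V \<in> S \<Longrightarrow> U \<subseteq> V \<Longrightarrow> U = V"
    using finite_has_maximal[of S] by blast
  then have UK: "U \<subseteq> K" and U0: "0 \<in> U"
    and Uadd: "\<And>w v. w \<in> U \<Longrightarrow> v \<in> U \<Longrightarrow> w + v \<in> U"
    by (auto simp: S_def)
  from U have "\<exists>t. (\<forall>w\<in>U. t w \<noteq> 0) \<and> (\<forall>w\<in>U. \<forall>v\<in>U. t (w + v) = t w * t v * c w v)"
    by (simp add: S_def)
  then obtain t where t_nz: "\<And>w. w \<in> U \<Longrightarrow> t w \<noteq> 0"
    and t: "\<And>w v. w \<in> U \<Longrightarrow> v \<in> U \<Longrightarrow> t (w + v) = t w * t v * c w v"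
    by metis
  have "U = K"
  proof (rule ccontr)
    assume "U \<noteq> K"
    then obtain s where s: "s \<in> K" "s \<notin> U" using UK by blast
    define r where "r = csqrt (c s s)"
    have r: "r * r = c s s" by (simp add: r_def flip: power2_eq_square)
    have rr: "r * (r * c s s) = 1" using c_sq[OF s(1) s(1)] r by (simp flip: mult.assoc)
    have r_nz: "r \<noteq> 0" using rr by auto
    have ss: "s + (s + w) = w" for w using self[OF s(1)] by (simp flip: add.assoc)
    have ss': "s + w \<notin> U" if "w \<in> U" for w
    proof
      assume "s + w \<in> U"
      then have "(s + w) + w \<in> U" using that Uadd by blast
      then show False using s self[of w] UK that by (auto simp: add.assoc)
    qed
    define V where "V = U \<union> (\<lambda>w. s + w) ` U"
    \<comment> \<open>Since s + s = 0, an element w of the coset has \<open>s + w\<close> as its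
      part in U; the new value at s itself is r.\<close>
    define t' where "t' w = (if w \<in> U then t w else t (s + w) * r * c (s + w) s)" for w
    have t'U: "t' w = t w" if "w \<in> U" for w using that by (simp add: t'_def)
    have t's: "t' (s + w) = t w * r * c w s" if "w \<in> U" for w
      using ss'[OF that] by (simp add: t'_def ss)
    have cU: "c w v = c v w" "c w (v + s) = c w v * c w s" "c (s + w) v = c s v * c w v"
      "c w v * c w v = 1"
      if "w \<in> K" "v \<in> K" for w v
      using that s UK c_sym c_add c_sq add by (simp_all add: c_sym[of w])
    have mixed: "t' (w + (s + v)) = t' w * t' (s + v) * c w (s + v)" if "w \<in> U" "v \<in> U" for w v
    proof -
      have K: "w \<in> K" "v \<in> K" using that UK by auto
      have "w + (s + v) = s + (w + v)" by (simp add: ac_simps)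
      then have "t' (w + (s + v)) = t (w + v) * r * c (w + v) s"
        using that by (simp only: t's Uadd)
      also have "\<dots> = t w * t v * c w v * r * (c w s * c v s)"
        using that K s by (simp add: t c_add)
      also have "\<dots> = t' w * t' (s + v) * c w (s + v)"
        using that cU(2)[OF K] by (simp only: t'U t's add.commute[of s v, symmetric]) (simp only: ac_simps)
      finally show ?thesis .
    qed
    have shifted: "t' ((s + w) + (s + v)) = t' (s + w) * t' (s + v) * c (s + w) (s + v)"
      if "w \<in> U" "v \<in> U" for w v
    proof -
      have K: "w \<in> K" "v \<in> K" "s + v \<in> K" using that UK s add by auto
      have "(s + w) + (s + v) = s + (s + (w + v))" by (simp add: ac_simps)
      also have "\<dots> = w + v" by (rule ss)
      finally have "t' ((s + w) + (s + v)) = t w * t v * c w v"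
        using that by (simp only: t'U Uadd t)
      \<comment> \<open>All inserted factors are 1, by \<open>rr\<close> and by the squares of
        \<open>c\<close>; they provide the terms that the right-hand side needs after
        reordering.\<close>
      also have "\<dots> = t w * t v * c w v * (r * (r * c s s)) * (c w s * c w s) * (c v s * c v s)"
        using K s cU(4) by (simp add: rr)
      also have "\<dots> = (t w * r * c w s) * (t v * r * c v s) * ((c s s * c v s) * (c w s * c w v))"
        by (simp only: ac_simps)
      also have "(c s s * c v s) * (c w s * c w v) = c (s + w) (s + v)"
      proof -
        have "c (s + w) (s + v) = c (s + v) s * c (s + v) w"
          using K s c_sym[of s "s + v"] c_sym[of w "s + v"] by (simp only: c_add)
        also have "\<dots> = (c s s * c v s) * (c s w * c v w)"
          using K s by (simp only: c_add)
        finally show ?thesis using K s c_sym[of s w] c_sym[of v w] by simp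
      qed
      finally show ?thesis using that by (simp add: t's)
    qed
    have "V \<in> S"
      unfolding S_def
    proof (intro CollectI conjI exI[of _ t'] ballI)
      show "V \<subseteq> K" using UK s add by (auto simp: V_def)
      show "0 \<in> V" using U0 by (simp add: V_def)
      show "w + v \<in> V" if "w \<in> V" "v \<in> V" for w v
      proof -
        have e: "(s + a) + b = s + (a + b)" "a + (s + b) = s + (a + b)" "(s + a) + (s + b) = a + b" for a b
          using ss[of "a + b"] by (simp_all only: ac_simps)
        have sV: "s + a \<in> V" "a \<in> V" if "a \<in> U" for a using that by (simp_all add: V_def)
        have "a + b \<in> V" "(s + a) + b \<in> V" "a + (s + b) \<in> V" "(s + a) + (s + b) \<in> V"
          if "a \<in> U" "b \<in> U" for a b
          using sV[OF Uadd[OF that]] by (simp_all only: e[of a b])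
        moreover have "w \<in> U \<or> (\<exists>a\<in>U. w = s + a)" "v \<in> U \<or> (\<exists>a\<in>U. v = s + a)"
          using that by (auto simp: V_def)
        ultimately show ?thesis by blast
      qed
      show "t' w \<noteq> 0" if "w \<in> V" for w
        using that t_nz r_nz c_nz UK s by (auto simp: V_def t'U t's)
      show "t' (w + v) = t' w * t' v * c w v" if "w \<in> V" "v \<in> V" for w v
      proof -
        have K: "w \<in> K" "v \<in> K" using that UK s add by (auto simp: V_def)
        consider "w \<in> U" "v \<in> U" | v' where "w \<in> U" "v = s + v'" "v' \<in> U"
          | w' where "w = s + w'" "w' \<in> U" "v \<in> U"
          | w' v' where "w = s + w'" "w' \<in> U" "v = s + v'" "v' \<in> U"
          using \<open>w \<in> V\<close> \<open>v \<in> V\<close> unfolding V_def by blast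
        then show ?thesis
        proof cases
          case 1
          then show ?thesis by (simp add: t'U Uadd t)
        next
          case 2
          then show ?thesis using mixed by simp
        next
          case 3
          have "t' (v + w) = t' v * t' w * c v w" using 3 mixed by simp
          then show ?thesis using c_sym[OF K] by (simp add: ac_simps)
        next
          case 4
          then show ?thesis using shifted by simp
        qed
      qed
    qed
    then have "U = V" using max by (simp add: V_def)
    moreover have "s + 0 \<in> V" using U0 unfolding V_def by blast
    ultimately show False using s by simp
  qed
  then show ?thesis using t t_nz by blast
qed

subsection \<open>Twisted group bases of the matrix algebra\<close>

context lie_algebra
begin

text \<open>Independence of the basis: expanding each basis in the other turns both diagonal sums
  into one double sum. This lets the Killing form be computed in the basis of the P_w.\<close>

lemma endo_trace_eq:
  assumes B: "independent B" "finite B" "span B = V"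
    and add: "\<And>x y. x \<in> V \<Longrightarrow> y \<in> V \<Longrightarrow> f (x + y) = f x + f y"
    and scale: "\<And>c x. x \<in> V \<Longrightarrow> f (scale c x) = scale c (f x)"
    and closed: "\<And>x. x \<in> V \<Longrightarrow> f x \<in> V"
  shows "endo_trace V f = (\<Sum>b\<in>B. representation B (f b) b)"
proof -
  define C where "C = (SOME C. independent C \<and> span C = V)"
  have C: "independent C" "span C = V"
    using someI[of "\<lambda>C. independent C \<and> span C = V" B] B unfolding C_def by blast+
  have "finite C"
    using independent_span_bound[OF B(2) C(1)] C(2) B(3) span_superset by blast
  have V: "subspace V" using B(3) subspace_span by blast
  have BV: "b \<in> V" if "b \<in> B" for b using that B(3) span_base by blast
  have CV: "c \<in> V" if "c \<in> C" for c using that C(2) span_base by blast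
  have f0: "f 0 = 0" using scale[of 0 0] V by (simp add: subspace_0)
  have f_sum: "f (\<Sum>b\<in>A. scale (g b) b) = (\<Sum>b\<in>A. scale (g b) (f b))"
    if "finite A" "A \<subseteq> V" for A g
    using that
  proof (induction A)
    case (insert a A)
    have "(\<Sum>b\<in>A. scale (g b) b) \<in> V"
      using insert.prems by (intro subspace_sum[OF V] subspace_scale[OF V]) auto
    with insert show ?case by (simp add: add scale subspace_scale[OF V])
  qed (simp add: f0)
  have "endo_trace V f = (\<Sum>c\<in>C. representation C (f c) c)"
    by (simp add: endo_trace_def C_def Let_def)
  also have "\<dots> = (\<Sum>c\<in>C. \<Sum>b\<in>B. representation B c b * representation C (f b) c)"
  proof (rule sum.cong[OF refl])
    fix c assume c: "c \<in> C"
    have "f c = f (\<Sum>b\<in>B. scale (representation B c b) b)"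
      using sum_representation_eq[OF B(1) _ B(2) order.refl] CV[OF c] B(3) by simp
    also have "\<dots> = (\<Sum>b\<in>B. scale (representation B c b) (f b))"
      using BV by (intro f_sum[OF B(2)]) auto
    finally have fc: "f c = \<dots>" .
    show "representation C (f c) c = (\<Sum>b\<in>B. representation B c b * representation C (f b) c)"
      unfolding fc using BV closed C subspace_scale[OF V]
      by (subst representation_sum) (auto simp: representation_scale)
  qed
  also have "\<dots> = (\<Sum>b\<in>B. \<Sum>c\<in>C. representation C (f b) c * representation B c b)"
    by (subst sum.swap) (simp add: mult.commute)
  also have "\<dots> = (\<Sum>b\<in>B. representation B (f b) b)"
  proof (rule sum.cong[OF refl])
    fix b assume b: "b \<in> B"
    have fb: "f b = (\<Sum>c\<in>C. scale (representation C (f b) c) c)"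
      using sum_representation_eq[OF C(1) _ \<open>finite C\<close> order.refl] closed BV[OF b] C(2) by simp
    show "(\<Sum>c\<in>C. representation C (f b) c * representation B c b) = representation B (f b) b"
      by (subst (2) fb, subst representation_sum)
        (use CV B subspace_scale[OF V] in \<open>auto simp: representation_scale\<close>)
  qed
  finally show ?thesis .
qed

end

lemma matrix_mult_sum_left:
  fixes f :: "'i \<Rightarrow> complex^'n^'n" and B :: "complex^'n^'n"
  shows "(\<Sum>i\<in>I. f i) ** B = (\<Sum>i\<in>I. f i ** B)"
  by (induction I rule: infinite_finite_induct) (simp_all add: matrix_mult_add_diff)

lemma matrix_mult_sum_right:
  fixes f :: "'i \<Rightarrow> complex^'n^'n" and B :: "complex^'n^'n"
  shows "B ** (\<Sum>i\<in>I. f i) = (\<Sum>i\<in>I. B ** f i)"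
  by (induction I rule: infinite_finite_induct) (simp_all add: matrix_mult_add_diff)

lemma trace_mat_scale: "trace (mat_scale c A) = c * trace A"
  by (simp add: trace_def mat_scale_def sum_distrib_left)

text \<open>The matrix algebra as a twisted group algebra of an elementary abelian 2-group. Linear
  independence is a consequence: by \<open>trace_P\<close>, the trace form separates the
  P_w.\<close>

locale twisted_basis =
  fixes K :: "'g::ab_group_add set"
    and eps :: "'g \<Rightarrow> 'g \<Rightarrow> complex"
    and P :: "'g \<Rightarrow> complex^'n^'n"
  assumes finite_K: "finite K"
    and zero_K: "0 \<in> K"
    and add_K: "w \<in> K \<Longrightarrow> v \<in> K \<Longrightarrow> w + v \<in> K"
    and self_K: "w \<in> K \<Longrightarrow> w + w = 0"
    and eps_nz: "w \<in> K \<Longrightarrow> v \<in> K \<Longrightarrow> eps w v \<noteq> 0"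
    and P_mult: "w \<in> K \<Longrightarrow> v \<in> K \<Longrightarrow> P w ** P v = mat_scale (eps w v) (P (w + v))"
    and P_0: "P 0 = mat 1"
    and trace_P: "w \<in> K \<Longrightarrow> w \<noteq> 0 \<Longrightarrow> trace (P w) = 0"
    and span_P: "mat_space.span (P ` K) = UNIV"
begin

section \<open>Coordinates and products in the twisted basis\<close>

lemma self_K_left: "w \<in> K \<Longrightarrow> w + (w + v) = v"
  by (simp add: self_K flip: add.assoc)

lemma self_K_right: "w \<in> K \<Longrightarrow> (v + w) + w = v"
  by (simp add: self_K add.assoc)

lemma add_eq_0_K: "w \<in> K \<Longrightarrow> w + v = 0 \<longleftrightarrow> v = w"
  by (metis self_K self_K_left add.right_neutral)

text \<open>The dual basis for the trace form: P_w squares to \<open>eps w w\<close> times the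
  identity, so dividing by this value and by the matrix size normalizes the pairing of P_w with
  itself.\<close>

definition coef :: "'g \<Rightarrow> complex^'n^'n \<Rightarrow> complex" where
  "coef w A = trace (A ** P w) / (eps w w * of_nat CARD('n))"

lemma coef_add: "coef w (A + B) = coef w A + coef w B"
  by (simp add: coef_def matrix_mult_add_diff trace_add add_divide_distrib)

lemma coef_diff: "coef w (A - B) = coef w A - coef w B"
  by (simp add: coef_def matrix_mult_add_diff trace_sub diff_divide_distrib)

lemma coef_scale: "coef w (mat_scale c A) = c * coef w A"
  by (simp add: coef_def mat_scale_mult trace_mat_scale)

lemma coef_0: "coef w 0 = 0"
  using coef_add[of w 0 0] by simp

lemma coef_sum: "coef w (\<Sum>i\<in>I. f i) = (\<Sum>i\<in>I. coef w (f i))"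
  by (induction I rule: infinite_finite_induct) (simp_all add: coef_add coef_0)

lemma coef_P:
  assumes "v \<in> K" "w \<in> K"
  shows "coef w (P v) = (if v = w then 1 else 0)"
  using assms eps_nz[of w w]
  by (auto simp: coef_def P_mult trace_mat_scale self_K P_0 trace_I trace_P add_K add_eq_0_K)

lemma coef_combination:
  assumes "w \<in> K"
  shows "coef w (\<Sum>v\<in>K. mat_scale (c v) (P v)) = c w"
proof -
  have "coef w (\<Sum>v\<in>K. mat_scale (c v) (P v)) = (\<Sum>v\<in>K. if v = w then c v else 0)"
    unfolding coef_sum using assms by (intro sum.cong) (auto simp: coef_scale coef_P)
  then show ?thesis using assms finite_K by simp
qed

lemma expansion: "(\<Sum>w\<in>K. mat_scale (coef w A) (P w)) = A"
proof -
  have "A \<in> mat_space.span (P ` K)" using span_P by simp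
  then show ?thesis
  proof (induction rule: mat_space.span_induct_alt)
    case base
    then show ?case by (simp add: coef_0)
  next
    case (step c x y)
    then obtain v where v: "v \<in> K" "x = P v" by blast
    have "(\<Sum>w\<in>K. mat_scale (coef w x) (P w)) = (\<Sum>w\<in>K. if w = v then P w else 0)"
      using v by (intro sum.cong) (auto simp: coef_P)
    also have "\<dots> = x" using v finite_K by simp
    finally have "(\<Sum>w\<in>K. mat_scale (coef w x) (P w)) = x" .
    then show ?case using step.IH
      by (simp add: coef_add coef_scale mat_space.scale_left_distrib sum.distrib
          flip: mat_space.scale_scale mat_space.scale_sum_right)
  qed
qed

lemma coef_eqI: "(\<And>w. w \<in> K \<Longrightarrow> coef w A = coef w B) \<Longrightarrow> A = B"
  by (subst (1 2) expansion[symmetric]) simp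

lemma sl_iff: "A \<in> sl \<longleftrightarrow> coef 0 A = 0"
  using eps_nz[OF zero_K zero_K] by (simp add: coef_def P_0 sl_def)

text \<open>Twisted convolution; \<open>z + w\<close> stands for the difference, as every element of
  K is its own negative.\<close>

lemma coef_mult:
  assumes z: "z \<in> K"
  shows "coef z (A ** B) = (\<Sum>w\<in>K. coef w A * coef (z + w) B * eps w (z + w))"
proof -
  have "coef z (A ** B) =
      coef z ((\<Sum>w\<in>K. mat_scale (coef w A) (P w)) ** (\<Sum>v\<in>K. mat_scale (coef v B) (P v)))"
    by (simp add: expansion)
  also have "\<dots> = (\<Sum>w\<in>K. \<Sum>v\<in>K. coef w A * coef v B * coef z (P w ** P v))"
    unfolding matrix_mult_sum_left unfolding matrix_mult_sum_right
    by (simp add: mat_scale_mult coef_sum coef_scale mult_ac)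
  also have "\<dots> = (\<Sum>w\<in>K. coef w A * coef (z + w) B * eps w (z + w))"
  proof (rule sum.cong[OF refl])
    fix w assume w: "w \<in> K"
    have "(\<Sum>v\<in>K. coef w A * coef v B * coef z (P w ** P v)) =
        (\<Sum>v\<in>K. if v = z + w then coef w A * coef v B * eps w v else 0)"
    proof (rule sum.cong[OF refl])
      fix v assume v: "v \<in> K"
      have "w + v = z \<longleftrightarrow> v = z + w"
        using self_K_left[OF w] by (metis add.commute)
      then show "coef w A * coef v B * coef z (P w ** P v) =
          (if v = z + w then coef w A * coef v B * eps w v else 0)"
        using v w z by (auto simp: P_mult coef_scale coef_P add_K)
    qed
    also have "\<dots> = coef w A * coef (z + w) B * eps w (z + w)"
      using finite_K add_K[OF z w] by simp
    finally show "(\<Sum>v\<in>K. coef w A * coef v B * coef z (P w ** P v)) =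
        coef w A * coef (z + w) B * eps w (z + w)" .
  qed
  finally show ?thesis .
qed

lemma bij_translate: "z \<in> K \<Longrightarrow> bij_betw (\<lambda>w. z + w) K K"
  by (rule bij_betwI[of _ _ _ "\<lambda>w. z + w"]) (auto simp: add_K self_K_left)

text \<open>The convolution indexed by the right factor. Next to \<open>coef_mult\<close> it lets A
  ** B and B ** A be compared term by term.\<close>

lemma coef_mult':
  assumes z: "z \<in> K"
  shows "coef z (A ** B) = (\<Sum>w\<in>K. coef (z + w) A * coef w B * eps (z + w) w)"
  unfolding coef_mult[OF z]
  by (subst sum.reindex_bij_betw[OF bij_translate[OF z], symmetric])
    (simp add: self_K_left[OF z])

lemma coef_commutator_P:
  assumes "z \<in> K" "u \<in> K"
  shows "coef z (commutator A (P u)) = coef (z + u) A * (eps (z + u) u - eps u (z + u))"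
proof -
  have "coef z (A ** P u) = (\<Sum>w\<in>K. if w = u then coef (z + w) A * eps (z + w) w else 0)"
    unfolding coef_mult'[OF assms(1)] using assms
    by (intro sum.cong) (auto simp: coef_P)
  moreover have "coef z (P u ** A) = (\<Sum>w\<in>K. if w = u then coef (z + w) A * eps w (z + w) else 0)"
    unfolding coef_mult[OF assms(1)] using assms
    by (intro sum.cong) (auto simp: coef_P)
  ultimately show ?thesis
    using assms finite_K by (simp add: commutator_def coef_diff algebra_simps)
qed

text \<open>For L inside K this is the span of the P_w with w in L - {0}, described by vanishing
  coefficients so that membership is tested one coefficient at a time. Leaving out 0 forces trace
  0.\<close>

definition block :: "'g set \<Rightarrow> (complex^'n^'n) set" where
  "block L = {A. \<forall>w\<in>K. w \<notin> L - {0} \<longrightarrow> coef w A = 0}"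

lemma block_coef: "A \<in> block L \<Longrightarrow> w \<in> K \<Longrightarrow> w \<notin> L \<Longrightarrow> coef w A = 0"
  by (auto simp: block_def)

lemma P_block: "w \<in> L \<Longrightarrow> w \<in> K \<Longrightarrow> w \<noteq> 0 \<Longrightarrow> P w \<in> block L"
  by (auto simp: block_def coef_P)

lemma block_subset_sl: "block L \<subseteq> sl"
  using zero_K by (auto simp: block_def sl_iff)

lemma subspace_block: "mat_space.subspace (block L)"
  by (auto simp: mat_space.subspace_def block_def coef_0 coef_add coef_scale)

lemma block_commute:
  assumes iso: "\<And>w v. w \<in> L \<Longrightarrow> v \<in> L \<Longrightarrow> eps w v = eps v w"
    and A: "A \<in> block L" and B: "B \<in> block L"
  shows "commutator A B = 0"
proof -
  have "A ** B = B ** A"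
  proof (rule coef_eqI)
    fix z assume z: "z \<in> K"
    show "coef z (A ** B) = coef z (B ** A)"
      unfolding coef_mult[OF z, of A] coef_mult'[OF z, of B]
    proof (rule sum.cong[OF refl])
      fix w assume w: "w \<in> K"
      \<comment> \<open>A term survives only when w and z + w both lie in L, where eps is
        symmetric.\<close>
      show "coef w A * coef (z + w) B * eps w (z + w) = coef (z + w) B * coef w A * eps (z + w) w"
        using block_coef[OF A w] block_coef[OF B add_K[OF z w]] iso[of w "z + w"]
        by (cases "w \<in> L \<and> z + w \<in> L") auto
    qed
  qed
  then show ?thesis by (simp add: commutator_def)
qed

text \<open>Isotropy makes the block abelian. For self-normalization, let u lie outside L and choose
  w in L not commuting with it: the bracket of A with P_w has at u + w, again outside L, a nonzero
  multiple of \<open>coef u A\<close>, which must therefore vanish.\<close>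

lemma cartan_block:
  assumes L: "L \<subseteq> K" "\<And>w v. w \<in> L \<Longrightarrow> v \<in> L \<Longrightarrow> w + v \<in> L"
    and iso: "\<And>w v. w \<in> L \<Longrightarrow> v \<in> L \<Longrightarrow> eps w v = eps v w"
    and max: "\<And>u. u \<in> K - L \<Longrightarrow> \<exists>w\<in>L. w \<noteq> 0 \<and> eps u w \<noteq> eps w u"
  shows "sl.cartan_subalgebra (block L)"
proof -
  have comm: "\<And>A B. A \<in> block L \<Longrightarrow> B \<in> block L \<Longrightarrow> commutator A B = 0"
    using block_commute[OF iso] by blast
  have 0: "0 \<in> block L" by (simp add: block_def coef_0)
  have sub: "sl.lie_subalgebra (block L)"
    by (simp add: sl.lie_subalgebra_def subspace_block block_subset_sl comm 0)
  have "{commutator x y |x y. x \<in> block L \<and> y \<in> block L} = {0}"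
    using comm 0 by force
  then have "sl.lower_central (block L) (Suc 0) = {0}"
    by simp
  with sub have "sl.nilpotent_subalgebra (block L)"
    unfolding sl.nilpotent_subalgebra_def by blast
  moreover have "sl.normalizer (block L) = block L"
  proof (intro equalityI subsetI)
    fix A assume A: "A \<in> sl.normalizer (block L)"
    then have A_sl: "A \<in> sl" and norm: "\<And>h. h \<in> block L \<Longrightarrow> commutator A h \<in> block L"
      by (auto simp: sl.normalizer_def)
    have "coef u A = 0" if u: "u \<in> K" "u \<notin> L - {0}" for u
    proof (cases "u = 0")
      case True
      then show ?thesis using A_sl by (simp add: sl_iff)
    next
      case False
      with u have "u \<in> K - L" by auto
      then obtain w where w: "w \<in> L" "w \<noteq> 0" "eps u w \<noteq> eps w u" using max by blast
      have wK: "w \<in> K" using w L by blast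
      have "u + w \<notin> L"
        using L(2)[of "u + w" w] w u False self_K_right[OF wK] by auto
      then have "coef (u + w) (commutator A (P w)) = 0"
        using norm[OF P_block[OF w(1) wK w(2)]] add_K[OF u(1) wK] by (auto simp: block_def)
      then show ?thesis
        using w by (simp add: coef_commutator_P[OF add_K[OF u(1) wK] wK] self_K_right[OF wK])
    qed
    then show "A \<in> block L" by (simp add: block_def)
  next
    fix A assume "A \<in> block L"
    then show "A \<in> sl.normalizer (block L)"
      using block_subset_sl comm 0 by (auto simp: sl.normalizer_def)
  qed
  ultimately show ?thesis by (simp add: sl.cartan_subalgebra_def)
qed

lemma inj_P: "inj_on P K"
proof (rule inj_onI)
  fix v w assume "v \<in> K" "w \<in> K" "P v = P w"
  then show "v = w" using coef_P[of v w] coef_P[of w w] by (auto split: if_splits)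
qed

lemma P_basis_sl:
  shows "mat_space.independent (P ` (K - {0}))"
    and "mat_space.span (P ` (K - {0})) = sl"
    and "A \<in> sl \<Longrightarrow> w \<in> K - {0} \<Longrightarrow> mat_space.representation (P ` (K - {0})) A (P w) = coef w A"
proof -
  let ?B = "P ` (K - {0})"
  have inj: "inj_on P (K - {0})" using inj_P by (rule inj_on_subset) auto
  have fin: "finite ?B" using finite_K by simp
  have zero: "c (P w) = 0" if "(\<Sum>b\<in>?B. mat_scale (c b) b) = 0" "w \<in> K - {0}" for c w
  proof -
    have "0 = (\<Sum>v\<in>K - {0}. mat_scale (c (P v)) (P v))"
      using that inj by (simp add: sum.reindex)
    \<comment> \<open>Padding with coefficient 0 at v = 0 extends the sum to all of K, as
      \<open>coef_combination\<close> requires.\<close>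
    also have "\<dots> = (\<Sum>v\<in>K. mat_scale (if v = 0 then 0 else c (P v)) (P v))"
      using finite_K by (intro sum.mono_neutral_cong_left) auto
    finally show ?thesis
      using coef_combination[of w "\<lambda>v. if v = 0 then 0 else c (P v)"] that by (auto simp: coef_0)
  qed
  show ind: "mat_space.independent ?B"
    using zero by (auto simp: mat_space.dependent_finite[OF fin])
  have sum: "(\<Sum>w\<in>K - {0}. mat_scale (coef w A) (P w)) = A" if "A \<in> sl" for A
    using that expansion[of A] finite_K zero_K by (simp add: sl_iff sum.remove[of K 0])
  show span: "mat_space.span ?B = sl"
  proof
    show "mat_space.span ?B \<subseteq> sl"
      by (rule mat_space.span_minimal[OF _ sl.subspace_L])
        (auto simp: sl_iff coef_P zero_K split: if_splits)
    have "A \<in> mat_space.span ?B" if "A \<in> sl" for A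
      by (subst sum[OF that, symmetric])
        (auto intro!: mat_space.span_sum mat_space.span_scale intro: mat_space.span_base)
    then show "sl \<subseteq> mat_space.span ?B" by blast
  qed
  show "mat_space.representation ?B A (P w) = coef w A" if A: "A \<in> sl" and w: "w \<in> K - {0}"
  proof -
    have "A = (\<Sum>b\<in>?B. mat_scale (mat_space.representation ?B A b) b)"
      using mat_space.sum_representation_eq[OF ind _ fin order.refl] A span by simp
    also have "\<dots> = (\<Sum>v\<in>K - {0}. mat_scale (mat_space.representation ?B A (P v)) (P v))"
      using inj by (simp add: sum.reindex)
    also have "\<dots> = (\<Sum>v\<in>K. mat_scale (if v = 0 then 0 else mat_space.representation ?B A (P v)) (P v))"
      using finite_K by (intro sum.mono_neutral_cong_left) auto
    finally have "coef w A = coef w \<dots>" by simp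
    then show ?thesis using w by (simp add: coef_combination)
  qed
qed

text \<open>For general A and B, the diagonal entry at P_u collects only multiples of products
  \<open>coef w A * coef w B\<close> with the same w, and disjoint supports kill each of
  them.\<close>

lemma killing_orthogonal_block:
  assumes "L \<inter> M \<subseteq> {0}"
  shows "sl.killing_orthogonal (block L) (block M)"
  unfolding sl.killing_orthogonal_def
proof (intro ballI)
  fix A B assume A: "A \<in> block L" and B: "B \<in> block M"
  have A_sl: "A \<in> sl" and B_sl: "B \<in> sl" using A B block_subset_sl by auto
  let ?f = "commutator A \<circ> commutator B"
  have f_sl: "?f X \<in> sl" if "X \<in> sl" for X
    using that A_sl B_sl by (simp add: sl.brk_closed)
  have AB: "coef w A * coef w B = 0" if "w \<in> K" for w
    using A B assms that by (auto simp: block_def)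
  have coef_f: "coef u (?f (P u)) = 0" if u: "u \<in> K" for u
  proof -
    let ?Z = "commutator B (P u)"
    have Z: "coef w A * coef (u + w) ?Z = 0" if w: "w \<in> K" for w
    proof -
      have e: "u + w + u = w" using self_K_right[OF u, of w] by (simp add: add.commute)
      show ?thesis unfolding coef_commutator_P[OF add_K[OF u w] u] e using AB[OF w] by auto
    qed
    have "coef u (A ** ?Z) = 0"
      unfolding coef_mult[OF u] using Z by (intro sum.neutral) simp
    moreover have "coef u (?Z ** A) = 0"
      unfolding coef_mult'[OF u] using Z by (intro sum.neutral) (simp add: mult.commute)
    ultimately show ?thesis by (simp add: commutator_def[of A] coef_diff)
  qed
  have "sl.killing_form A B = (\<Sum>b\<in>P ` (K - {0}). mat_space.representation (P ` (K - {0})) (?f b) b)"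
    unfolding sl.killing_form_def
  proof (rule sl.endo_trace_eq)
    show "mat_space.independent (P ` (K - {0}))" by (rule P_basis_sl)
    show "mat_space.span (P ` (K - {0})) = sl" by (rule P_basis_sl)
    show "?f (X + Y) = ?f X + ?f Y" if "X \<in> sl" "Y \<in> sl" for X Y
      using that A_sl B_sl by (simp add: sl.brk_add_right sl.brk_closed)
    show "?f (mat_scale c X) = mat_scale c (?f X)" if "X \<in> sl" for c X
      using that A_sl B_sl by (simp add: sl.brk_scale_right sl.brk_closed)
  qed (use f_sl finite_K in auto)
  also have "\<dots> = 0"
  proof (rule sum.neutral, rule ballI)
    fix b assume "b \<in> P ` (K - {0})"
    then obtain w where w: "w \<in> K - {0}" "b = P w" by blast
    then have "P w \<in> sl" by (simp add: sl_def trace_P)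
    then have "mat_space.representation (P ` (K - {0})) (?f (P w)) (P w) = coef w (?f (P w))"
      using w(1) by (intro P_basis_sl(3)[OF f_sl])
    then show "mat_space.representation (P ` (K - {0})) (?f b) b = 0"
      using coef_f w by simp
  qed
  finally show "sl.killing_form A B = 0" .
qed

text \<open>Each nonzero w belongs to one index only, so a coefficient of the sum is the coefficient
  of a single summand.\<close>

lemma direct_sum_blocks:
  assumes fin: "finite I"
    and part: "\<And>w. w \<in> K - {0} \<Longrightarrow> \<exists>!i. i \<in> I \<and> w \<in> L i"
  shows "sl.direct_sum_decomp I (\<lambda>i. block (L i))"
  unfolding sl.direct_sum_decomp_def
proof (intro conjI ballI fin subspace_block)
  have coef_h: "coef w (\<Sum>j\<in>I. h j) = coef w (h i)"
    if h: "\<And>j. j \<in> I \<Longrightarrow> h j \<in> block (L j)" and w: "w \<in> K - {0}" and i: "i \<in> I" "w \<in> L i"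
    for h w i
  proof -
    have "coef w (h j) = 0" if "j \<in> I - {i}" for j
      using part[OF w] w i that h[of j] by (auto simp: block_def)
    then show ?thesis
      unfolding coef_sum using fin i by (simp add: sum.remove[of I i])
  qed
  show "bij_betw (\<lambda>h. \<Sum>i\<in>I. h i) (\<Pi>\<^sub>E i\<in>I. block (L i)) sl"
    unfolding bij_betw_def
  proof
    show "inj_on (\<lambda>h. \<Sum>i\<in>I. h i) (\<Pi>\<^sub>E i\<in>I. block (L i))"
    proof (rule inj_onI)
      fix g h assume g: "g \<in> (\<Pi>\<^sub>E i\<in>I. block (L i))" and h: "h \<in> (\<Pi>\<^sub>E i\<in>I. block (L i))"
        and eq: "(\<Sum>i\<in>I. g i) = (\<Sum>i\<in>I. h i)"
      show "g = h"
      proof (rule PiE_ext[OF g h])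
        fix i assume i: "i \<in> I"
        have gh: "\<And>j. j \<in> I \<Longrightarrow> g j \<in> block (L j)" "\<And>j. j \<in> I \<Longrightarrow> h j \<in> block (L j)"
          using g h by auto
        show "g i = h i"
        proof (rule coef_eqI)
          fix w assume w: "w \<in> K"
          show "coef w (g i) = coef w (h i)"
          proof (cases "w \<in> L i - {0}")
            case True
            then have w': "w \<in> K - {0}" "w \<in> L i" using w by auto
            show ?thesis
              using coef_h[of g, OF gh(1) w'(1) i w'(2)] coef_h[of h, OF gh(2) w'(1) i w'(2)] eq
              by simp
          next
            case False
            then show ?thesis using gh[OF i] w by (simp add: block_def)
          qed
        qed
      qed
    qed
    show "(\<lambda>h. \<Sum>i\<in>I. h i) ` (\<Pi>\<^sub>E i\<in>I. block (L i)) = sl"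
    proof (intro equalityI subsetI)
      fix A assume "A \<in> (\<lambda>h. \<Sum>i\<in>I. h i) ` (\<Pi>\<^sub>E i\<in>I. block (L i))"
      then show "A \<in> sl"
        using block_subset_sl by (auto intro!: mat_space.subspace_sum[OF sl.subspace_L])
    next
      fix A :: "complex^'n^'n" assume A: "A \<in> sl"
      \<comment> \<open>Component i keeps the coefficients of A supported on L i; restricting to I
        makes the family extensional.\<close>
      define h where "h = (\<lambda>i\<in>I. \<Sum>w\<in>K. mat_scale (if w \<in> L i - {0} then coef w A else 0) (P w))"
      have h: "h i \<in> block (L i)" if "i \<in> I" for i
        using that by (auto simp: h_def block_def coef_combination)
      have "(\<Sum>i\<in>I. h i) = A"
      proof (rule coef_eqI)
        fix w assume w: "w \<in> K"
        show "coef w (\<Sum>i\<in>I. h i) = coef w A"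
        proof (cases "w = 0")
          case True
          have "(\<Sum>i\<in>I. h i) \<in> sl"
            using h block_subset_sl by (intro mat_space.subspace_sum[OF sl.subspace_L]) auto
          then show ?thesis using A True by (simp add: sl_iff)
        next
          case False
          then obtain i where i: "i \<in> I" "w \<in> L i" using part[of w] w by blast
          then show ?thesis
            using coef_h[of h w i] h w False by (simp add: h_def coef_combination)
        qed
      qed
      moreover have "h \<in> (\<Pi>\<^sub>E i\<in>I. block (L i))" using h by (auto simp: h_def)
      ultimately show "A \<in> (\<lambda>h. \<Sum>i\<in>I. h i) ` (\<Pi>\<^sub>E i\<in>I. block (L i))" by blast
    qed
  qed
qed

section \<open>Lie automorphisms from symmetries of the cocycle\<close>

definition symmetry :: "('g \<Rightarrow> 'g) \<Rightarrow> bool" where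
  "symmetry \<sigma> \<longleftrightarrow> bij_betw \<sigma> K K \<and> (\<forall>w\<in>K. \<forall>v\<in>K. \<sigma> (w + v) = \<sigma> w + \<sigma> v) \<and>
     (\<forall>w\<in>K. \<forall>v\<in>K. eps (\<sigma> w) (\<sigma> v) = eps w v)"

lemma symmetryD:
  assumes "symmetry \<sigma>"
  shows "bij_betw \<sigma> K K" "w \<in> K \<Longrightarrow> \<sigma> w \<in> K"
    "w \<in> K \<Longrightarrow> v \<in> K \<Longrightarrow> \<sigma> (w + v) = \<sigma> w + \<sigma> v"
    "w \<in> K \<Longrightarrow> v \<in> K \<Longrightarrow> eps (\<sigma> w) (\<sigma> v) = eps w v"
    "w \<in> K \<Longrightarrow> v \<in> K \<Longrightarrow> \<sigma> w = \<sigma> v \<longleftrightarrow> w = v"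
  using assms by (auto simp: symmetry_def bij_betw_def inj_on_eq_iff)

lemma symmetry_0: "symmetry \<sigma> \<Longrightarrow> \<sigma> 0 = 0"
  using symmetryD(3)[of \<sigma> 0 0] zero_K by simp

lemma symmetry_E:
  assumes "symmetry \<sigma>" "w \<in> K"
  obtains v where "v \<in> K" "w = \<sigma> v"
  using assms symmetryD(1)[OF assms(1)] by (metis bij_betw_imp_surj_on imageE)

lemma symmetry_funpow:
  assumes "symmetry \<sigma>"
  shows "symmetry (\<sigma> ^^ n)"
proof (induction n)
  case 0
  show ?case using bij_betw_id[of K] by (simp add: symmetry_def id_def)
next
  case (Suc n)
  have "bij_betw (\<sigma> ^^ Suc n) K K"
    using bij_betw_trans[OF symmetryD(1)[OF Suc] symmetryD(1)[OF assms]] by (simp add: o_def)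
  then show ?case
    using symmetryD(2-4)[OF Suc] symmetryD(2-4)[OF assms] by (simp add: symmetry_def o_def)
qed

definition permute :: "('g \<Rightarrow> 'g) \<Rightarrow> complex^'n^'n \<Rightarrow> complex^'n^'n" where
  "permute \<sigma> A = (\<Sum>w\<in>K. mat_scale (coef w A) (P (\<sigma> w)))"

lemma coef_permute:
  assumes \<sigma>: "symmetry \<sigma>" and w: "w \<in> K"
  shows "coef (\<sigma> w) (permute \<sigma> A) = coef w A"
proof -
  have "coef (\<sigma> w) (permute \<sigma> A) = (\<Sum>v\<in>K. if v = w then coef v A else 0)"
    unfolding permute_def coef_sum using w symmetryD[OF \<sigma>]
    by (intro sum.cong) (auto simp: coef_scale coef_P)
  then show ?thesis using w finite_K by simp
qed

lemma permute_eqI: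
  assumes \<sigma>: "symmetry \<sigma>" and eq: "\<And>w. w \<in> K \<Longrightarrow> coef w A = coef (\<sigma> w) B"
  shows "permute \<sigma> A = B"
  by (rule coef_eqI) (metis symmetry_E[OF \<sigma>] coef_permute[OF \<sigma>] eq)

lemma permute_comp:
  assumes "symmetry \<sigma>" "symmetry \<tau>" "symmetry (\<sigma> \<circ> \<tau>)"
  shows "permute (\<sigma> \<circ> \<tau>) A = permute \<sigma> (permute \<tau> A)"
  using assms by (intro permute_eqI) (simp_all add: coef_permute symmetryD)

lemma permute_P: "symmetry \<sigma> \<Longrightarrow> w \<in> K \<Longrightarrow> permute \<sigma> (P w) = P (\<sigma> w)"
  by (rule permute_eqI) (auto simp: coef_P symmetryD)

lemma permute_add: "permute \<sigma> (A + B) = permute \<sigma> A + permute \<sigma> B"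
  by (simp add: permute_def coef_add mat_space.scale_left_distrib sum.distrib)

lemma permute_diff: "permute \<sigma> (A - B) = permute \<sigma> A - permute \<sigma> B"
  by (simp add: permute_def coef_diff mat_space.scale_left_diff_distrib sum_subtractf)

lemma permute_scale: "permute \<sigma> (mat_scale c A) = mat_scale c (permute \<sigma> A)"
  by (simp add: permute_def coef_scale mat_space.scale_sum_right)

text \<open>Reindexing the twisted convolution by \<sigma>. This needs eps itself to be invariant;
  invariance of its commutator pairing would leave scalar factors behind.\<close>

lemma permute_mult:
  assumes \<sigma>: "symmetry \<sigma>"
  shows "permute \<sigma> (A ** B) = permute \<sigma> A ** permute \<sigma> B"
proof (rule permute_eqI[OF \<sigma>])
  fix z assume z: "z \<in> K"
  have "coef (\<sigma> z) (permute \<sigma> A ** permute \<sigma> B) =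
      (\<Sum>w\<in>K. coef (\<sigma> w) (permute \<sigma> A) * coef (\<sigma> z + \<sigma> w) (permute \<sigma> B) * eps (\<sigma> w) (\<sigma> z + \<sigma> w))"
    unfolding coef_mult[OF symmetryD(2)[OF \<sigma> z]]
    by (rule sum.reindex_bij_betw[OF symmetryD(1)[OF \<sigma>], symmetric])
  also have "\<dots> = coef z (A ** B)"
    unfolding coef_mult[OF z]
  proof (rule sum.cong[OF refl])
    fix w assume w: "w \<in> K"
    show "coef (\<sigma> w) (permute \<sigma> A) * coef (\<sigma> z + \<sigma> w) (permute \<sigma> B) * eps (\<sigma> w) (\<sigma> z + \<sigma> w) =
        coef w A * coef (z + w) B * eps w (z + w)"
      using w z add_K[OF z w] symmetryD(4)[OF \<sigma>]
      by (simp add: coef_permute[OF \<sigma>] flip: symmetryD(3)[OF \<sigma>])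
  qed
  finally show "coef z (A ** B) = coef (\<sigma> z) (permute \<sigma> A ** permute \<sigma> B)" by simp
qed

lemma permute_block:
  assumes \<sigma>: "symmetry \<sigma>" and L: "L \<subseteq> K"
  shows "permute \<sigma> ` block L = block (\<sigma> ` L)"
proof (intro equalityI subsetI)
  fix B assume "B \<in> permute \<sigma> ` block L"
  then obtain A where A: "A \<in> block L" "B = permute \<sigma> A" by blast
  show "B \<in> block (\<sigma> ` L)"
    unfolding block_def
  proof (intro CollectI ballI impI)
    fix w assume w: "w \<in> K" "w \<notin> \<sigma> ` L - {0}"
    then obtain v where v: "v \<in> K" "w = \<sigma> v" using symmetry_E[OF \<sigma>] by blast
    then have "v \<notin> L - {0}" using w symmetry_0[OF \<sigma>] symmetryD(5)[OF \<sigma> v(1) zero_K] by auto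
    then show "coef w B = 0" using A v coef_permute[OF \<sigma>] by (simp add: block_def)
  qed
next
  fix B assume B: "B \<in> block (\<sigma> ` L)"
  let ?A = "\<Sum>w\<in>K. mat_scale (coef (\<sigma> w) B) (P w)"
  have "?A \<in> block L"
    unfolding block_def
  proof (intro CollectI ballI impI)
    fix w assume w: "w \<in> K" "w \<notin> L - {0}"
    then have "\<sigma> w \<notin> \<sigma> ` L - {0}"
      using symmetry_0[OF \<sigma>] symmetryD(5)[OF \<sigma> w(1)] L by auto
    then show "coef w ?A = 0"
      using B w(1) symmetryD(2)[OF \<sigma>] by (simp add: block_def coef_combination)
  qed
  moreover have "B = permute \<sigma> ?A"
    using \<sigma> by (rule permute_eqI[symmetric]) (simp add: coef_combination)
  ultimately show "B \<in> permute \<sigma> ` block L" by (rule rev_image_eqI)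
qed

lemma block_K: "block K = sl"
  using zero_K by (auto simp: block_def sl_iff)

lemma permute_lie_auts:
  assumes \<sigma>: "symmetry \<sigma>"
  shows "restrict (permute \<sigma>) sl \<in> sl.lie_auts"
proof -
  have inj: "inj_on (permute \<sigma>) sl"
    by (rule inj_onI) (metis coef_eqI coef_permute[OF \<sigma>])
  \<comment> \<open>Surjectivity is the block statement for the full index set, since
    \<open>block K\<close> is all of \<open>sl\<close>.\<close>
  have img: "permute \<sigma> ` sl = sl"
    using permute_block[OF \<sigma>, of K] symmetryD(1)[OF \<sigma>] by (simp add: block_K bij_betw_def)
  have "permute \<sigma> (commutator A B) = commutator (permute \<sigma> A) (permute \<sigma> B)" for A B
    by (simp add: commutator_def permute_diff permute_mult[OF \<sigma>])
  moreover have "A + B \<in> sl" "mat_scale c A \<in> sl" if "A \<in> sl" "B \<in> sl" for c and A B :: "complex^'n^'n"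
    using that by (simp_all add: mat_space.subspace_add[OF sl.subspace_L]
        mat_space.subspace_scale[OF sl.subspace_L])
  ultimately show ?thesis
    using inj img
    by (simp add: sl.lie_auts_def Bij_def bij_betw_def permute_add permute_scale sl.brk_closed inj_on_restrict_eq)
qed

lemma lie_aut_group_mult:
  assumes "f \<in> sl.lie_auts" "g \<in> sl.lie_auts"
  shows "f \<otimes>\<^bsub>sl.lie_aut_group\<^esub> g = compose (sl :: (complex^'n^'n) set) f g"
  using assms by (simp add: sl.lie_aut_group_def BijGroup_def sl.lie_auts_def)

lemma permute_pow:
  assumes \<sigma>: "symmetry \<sigma>"
  shows "restrict (permute \<sigma>) sl [^]\<^bsub>sl.lie_aut_group\<^esub> (n::nat) = restrict (permute (\<sigma> ^^ n)) sl"
proof (induction n)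
  case 0
  have "permute (\<lambda>w. w) A = A" for A
    using bij_betw_id[of K] by (intro permute_eqI) (simp_all add: symmetry_def id_def)
  then show ?case
    by (simp add: sl.lie_aut_group_def BijGroup_def id_def)
next
  case (Suc n)
  have sl: "permute \<sigma> A \<in> sl" if "A \<in> sl" for A
    using that permute_block[OF \<sigma>, of K] symmetryD(1)[OF \<sigma>] by (auto simp: block_K bij_betw_def)
  have "\<sigma> ^^ Suc n = (\<sigma> ^^ n) \<circ> \<sigma>" by (rule funpow_Suc_right)
  then have "permute (\<sigma> ^^ Suc n) A = permute (\<sigma> ^^ n) (permute \<sigma> A)" for A
    using permute_comp[OF symmetry_funpow[OF \<sigma>, of n] \<sigma>] symmetry_funpow[OF \<sigma>, of "Suc n"] by simp
  then have "compose sl (restrict (permute (\<sigma> ^^ n)) sl) (restrict (permute \<sigma>) sl) =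
      restrict (permute (\<sigma> ^^ Suc n)) sl"
    using sl by (auto simp: compose_def simp del: funpow.simps intro!: ext)
  then show ?case
    unfolding nat_pow_Suc Suc
      lie_aut_group_mult[OF permute_lie_auts[OF symmetry_funpow[OF \<sigma>]] permute_lie_auts[OF \<sigma>]] .
qed

text \<open>P is injective on K and P_w is traceless for nonzero w, so a power acting trivially on
  \<open>sl\<close> fixes every index; the index 0 is fixed by any symmetry.\<close>

lemma ord_permute:
  assumes \<sigma>: "symmetry \<sigma>" and ord: "\<And>n. (\<forall>w\<in>K. (\<sigma> ^^ n) w = w) \<longleftrightarrow> N dvd n"
  shows "group.ord sl.lie_aut_group (restrict (permute \<sigma>) sl) = N"
proof -
  let ?G = "sl.lie_aut_group :: (complex^'n^'n \<Rightarrow> complex^'n^'n) monoid"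
  interpret G: group ?G by (rule sl.group_lie_aut_group)
  have carrier: "restrict (permute \<sigma>) sl \<in> carrier ?G"
    using permute_lie_auts[OF \<sigma>] by (simp add: sl.lie_aut_group_def)
  have one: "\<one>\<^bsub>?G\<^esub> = (\<lambda>A\<in>sl. A)" by (simp add: sl.lie_aut_group_def BijGroup_def)
  have "restrict (permute (\<sigma> ^^ n)) sl = (\<lambda>A\<in>sl. A) \<longleftrightarrow> (\<forall>w\<in>K. (\<sigma> ^^ n) w = w)" for n
  proof
    assume eq: "restrict (permute (\<sigma> ^^ n)) sl = (\<lambda>A\<in>sl. A)"
    show "\<forall>w\<in>K. (\<sigma> ^^ n) w = w"
    proof
      fix w assume w: "w \<in> K"
      show "(\<sigma> ^^ n) w = w"
      proof (cases "w = 0")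
        case True
        then show ?thesis using symmetry_0[OF symmetry_funpow[OF \<sigma>]] by simp
      next
        case False
        then have "P w \<in> sl" using w by (simp add: sl_def trace_P)
        then have "P ((\<sigma> ^^ n) w) = P w"
          using fun_cong[OF eq, of "P w"] permute_P[OF symmetry_funpow[OF \<sigma>] w, of n] by simp
        then show ?thesis
          using inj_P w symmetryD(2)[OF symmetry_funpow[OF \<sigma>] w] by (simp add: inj_on_eq_iff)
      qed
    qed
  next
    assume "\<forall>w\<in>K. (\<sigma> ^^ n) w = w"
    then have "permute (\<sigma> ^^ n) A = A" for A
      using symmetry_funpow[OF \<sigma>] by (intro permute_eqI) auto
    then show "restrict (permute (\<sigma> ^^ n)) sl = (\<lambda>A\<in>sl. A)"
      by (simp add: restrict_def fun_eq_iff)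
  qed
  then show ?thesis
    using ord by (simp add: G.ord_unique[OF carrier] permute_pow[OF \<sigma>] one)
qed

text \<open>The family L runs over all natural numbers and has period N, so \<sigma> is a pure shift
  of the index, with no separate wraparound case.\<close>

lemma transitive_blocks:
  assumes \<sigma>: "symmetry \<sigma>" and N: "N > 0"
    and ord: "\<And>n. (\<forall>w\<in>K. (\<sigma> ^^ n) w = w) \<longleftrightarrow> N dvd n"
    and L: "\<And>i. L i \<subseteq> K" and step: "\<And>i. L (Suc i) = \<sigma> ` L i"
  shows "transitive_action (subgroup_generated sl.lie_aut_group {restrict (permute \<sigma>) sl})
      ((\<lambda>i. block (L i)) ` {1..N}) (\<lambda>g. \<lambda>X\<in>(\<lambda>i. block (L i)) ` {1..N}. g ` X)"
proof -
  let ?G = "sl.lie_aut_group :: (complex^'n^'n \<Rightarrow> complex^'n^'n) monoid"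
  let ?\<phi> = "restrict (permute \<sigma>) sl"
  let ?S = "subgroup_generated ?G {?\<phi>}"
  let ?E = "(\<lambda>i. block (L i)) ` {1..N}"
  let ?act = "\<lambda>g. \<lambda>X\<in>?E. g ` X"
  interpret G: group ?G by (rule sl.group_lie_aut_group)
  have carrier: "?\<phi> \<in> carrier ?G"
    using permute_lie_auts[OF \<sigma>] by (simp add: sl.lie_aut_group_def)
  have L_add: "L (i + n) = (\<sigma> ^^ n) ` L i" for i n
    by (induction n) (simp_all add: step image_image)
  have L_period: "L (i + N * k) = L i" for i k
  proof -
    have "(\<sigma> ^^ (N * k)) w = w" if "w \<in> L i" for w
      using ord[of "N * k"] L that by auto
    then show ?thesis by (simp add: L_add)
  qed
  have in_E: "block (L i) \<in> ?E" for i
  proof -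
    \<comment> \<open>Passes to the representative of i in {1..N}; the added N keeps the subtraction
      of 1 from truncating at i = 0.\<close>
    have "i + N = Suc ((i + N - 1) mod N) + N * ((i + N - 1) div N)"
      using N mod_mult_div_eq[of "i + N - 1" N] by simp
    then have "L i = L (Suc ((i + N - 1) mod N))"
      using L_period by (metis mult_1_right)
    then show ?thesis using N by (intro image_eqI[of _ _ "Suc ((i + N - 1) mod N)"]) (simp_all add: Suc_le_eq)
  qed
  have S_carrier: "carrier ?S = range (\<lambda>n::nat. restrict (permute (\<sigma> ^^ n)) sl)"
  proof -
    \<comment> \<open>The generated subgroup consists of integer powers; finite order reduces them
      to natural exponents.\<close>
    have int_nat: "?\<phi> [^]\<^bsub>?G\<^esub> (k::int) = ?\<phi> [^]\<^bsub>?G\<^esub> nat (k mod int N)" for k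
    proof -
      have "?\<phi> [^]\<^bsub>?G\<^esub> k = ?\<phi> [^]\<^bsub>?G\<^esub> (k mod int N)"
        using ord_permute[OF \<sigma> ord] by (simp add: G.int_pow_eq[OF carrier] mod_eq_dvd_iff[symmetric])
      also have "\<dots> = ?\<phi> [^]\<^bsub>?G\<^esub> int (nat (k mod int N))" using N by simp
      finally show ?thesis by (simp only: int_pow_int)
    qed
    then show ?thesis
      unfolding G.carrier_subgroup_generated_by_singleton[OF carrier] permute_pow[OF \<sigma>, symmetric]
      using int_nat int_pow_int[of ?G ?\<phi>, symmetric] by (intro equalityI image_subsetI) (metis rangeI)+
  qed
  have S_aut: "g \<in> sl.lie_auts" if "g \<in> carrier ?S" for g
    using that permute_lie_auts[OF symmetry_funpow[OF \<sigma>]] by (auto simp: S_carrier)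
  have act_block: "restrict (permute (\<sigma> ^^ n)) sl ` block (L i) = block (L (i + n))" for n i
  proof -
    have "restrict (permute (\<sigma> ^^ n)) sl ` block (L i) = permute (\<sigma> ^^ n) ` block (L i)"
      using block_subset_sl by (intro image_cong) auto
    then show ?thesis by (simp add: permute_block[OF symmetry_funpow[OF \<sigma>] L] L_add)
  qed
  have act_E: "g ` X \<in> ?E" if gX: "g \<in> carrier ?S" "X \<in> ?E" for g X
  proof -
    obtain n i where "g = restrict (permute (\<sigma> ^^ n)) sl" "X = block (L i)"
      using gX unfolding S_carrier by blast
    then show ?thesis using in_E by (simp only: act_block)
  qed
  have E_sl: "X \<subseteq> sl" if "X \<in> ?E" for X using that block_subset_sl by auto
  have act_Bij: "?act g \<in> Bij ?E" if g: "g \<in> carrier ?S" for g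
  proof -
    have "inj_on g sl" using S_aut[OF g] by (auto simp: sl.lie_auts_def Bij_def bij_betw_def)
    then have inj: "inj_on (?act g) ?E"
      using E_sl by (intro inj_onI) (simp add: inj_on_image_eq_iff)
    moreover have "?act g ` ?E \<subseteq> ?E" using act_E[OF g] by auto
    ultimately have "?act g ` ?E = ?E" by (intro endo_inj_surj) auto
    with inj show ?thesis by (simp add: Bij_def bij_betw_def)
  qed
  have "group_action ?S ?E ?act"
    unfolding group_action_def
  proof (rule group_hom.intro)
    show "group ?S" by (rule G.group_subgroup_generated)
    show "group (BijGroup ?E)" by (rule group_BijGroup)
    show "group_hom_axioms ?S (BijGroup ?E) ?act"
    proof (intro group_hom_axioms.intro homI)
      show "?act g \<in> carrier (BijGroup ?E)" if "g \<in> carrier ?S" for g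
        using act_Bij[OF that] by (simp add: BijGroup_def)
      fix g h assume gh: "g \<in> carrier ?S" "h \<in> carrier ?S"
      have "?act (g \<otimes>\<^bsub>?S\<^esub> h) = compose ?E (?act g) (?act h)"
      proof
        fix X
        show "?act (g \<otimes>\<^bsub>?S\<^esub> h) X = compose ?E (?act g) (?act h) X"
        proof (cases "X \<in> ?E")
          case True
          have "compose sl g h ` X = g ` h ` X"
            using E_sl[OF True] by (auto simp: compose_def image_image intro!: image_cong)
          then show ?thesis
            using True act_E[OF gh(2) True] S_aut gh
            by (simp add: lie_aut_group_mult compose_eq)
        qed (simp add: compose_def)
      qed
      then show "?act (g \<otimes>\<^bsub>?S\<^esub> h) = ?act g \<otimes>\<^bsub>BijGroup ?E\<^esub> ?act h"
        using act_Bij gh by (simp add: BijGroup_def)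
    qed
  qed
  moreover have "\<exists>g\<in>carrier ?S. ?act g X = Y" if XY: "X \<in> ?E" "Y \<in> ?E" for X Y
  proof -
    obtain i j where ij: "i \<in> {1..N}" "X = block (L i)" "j \<in> {1..N}" "Y = block (L j)"
      using XY by blast
    \<comment> \<open>Adding N keeps the exponent from truncating when j < i, and by periodicity it
      does not change the block reached.\<close>
    let ?g = "restrict (permute (\<sigma> ^^ (j + N - i))) sl"
    have "i + (j + N - i) = j + N * 1" using ij by simp
    then have "?g ` X = Y" unfolding ij act_block by (simp only: L_period)
    then show ?thesis using XY(1) by (intro bexI[of _ ?g]) (auto simp: S_carrier)
  qed
  ultimately show ?thesis
    by (simp add: transitive_action_def transitive_action_axioms_def)
qed

end

subsection \<open>Weyl matrices over a quadratic extension\<close>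

definition rel_trace :: "nat \<Rightarrow> F2bar \<Rightarrow> F2bar" where
  "rel_trace m x = x + x ^ 2 ^ m"

lemma frobenius_twice: "x \<in> GF2 (2 * m) \<Longrightarrow> (x ^ 2 ^ m) ^ 2 ^ m = x"
  by (simp add: GF2_def mult_2 power_add flip: power_mult)

lemma rel_trace_in: "x \<in> GF2 (2 * m) \<Longrightarrow> rel_trace m x \<in> GF2 m"
  by (simp add: rel_trace_def GF2_def[of m] frobenius_add frobenius_twice add.commute)

lemma rel_trace_add: "rel_trace m (x + y) = rel_trace m x + rel_trace m y"
  by (simp add: rel_trace_def frobenius_add ac_simps)

lemma rel_trace_eq_0: "rel_trace m x = 0 \<longleftrightarrow> x \<in> GF2 m"
  by (auto simp: rel_trace_def GF2_def add_eq_0_F2bar)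

locale quadratic_extension =
  fixes m :: nat and \<gamma> :: F2bar
  assumes m: "m > 0" and \<gamma>: "\<gamma> ^ 2 ^ m = \<gamma> + 1"
begin

abbreviation "F \<equiv> GF2 m"
abbreviation "K \<equiv> GF2 (2 * m)"

lemma \<gamma>_in: "\<gamma> \<in> K"
proof -
  have "\<gamma> ^ 2 ^ (2 * m) = (\<gamma> ^ 2 ^ m) ^ 2 ^ m" by (simp add: mult_2 power_add flip: power_mult)
  then show ?thesis by (simp add: GF2_def \<gamma> frobenius_add two_eq_0_F2bar)
qed

definition eps :: "F2bar \<Rightarrow> F2bar \<Rightarrow> complex" where
  "eps w v = sign_char m (rel_trace m (\<gamma> * w * v ^ 2 ^ m))"

lemma eps_add_left:
  "w \<in> K \<Longrightarrow> v \<in> K \<Longrightarrow> u \<in> K \<Longrightarrow> eps (w + v) u = eps w u * eps v u"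
  by (simp add: eps_def distrib_left distrib_right rel_trace_add sign_char_add rel_trace_in \<gamma>_in)

lemma rel_trace_\<gamma>:
  "v \<in> K \<Longrightarrow> rel_trace m (\<gamma> * w * v ^ 2 ^ m) = \<gamma> * w * v ^ 2 ^ m + (\<gamma> + 1) * w ^ 2 ^ m * v"
  by (simp add: rel_trace_def power_mult_distrib frobenius_twice \<gamma>)

text \<open>The conjugate of \<open>\<gamma>\<close> is gamma + 1, so exchanging w and v and adding
  cancels \<open>\<gamma>\<close> and leaves a symplectic form.\<close>

lemma eps_swap:
  assumes "w \<in> K" "v \<in> K"
  shows "eps w v * eps v w = sign_char m (w * v ^ 2 ^ m + v * w ^ 2 ^ m)"
proof -
  have "rel_trace m (\<gamma> * w * v ^ 2 ^ m) + rel_trace m (\<gamma> * v * w ^ 2 ^ m) =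
      w * v ^ 2 ^ m + v * w ^ 2 ^ m"
    unfolding rel_trace_\<gamma>[OF assms(1)] rel_trace_\<gamma>[OF assms(2)] by (simp add: algebra_simps)
  then show ?thesis
    using assms by (simp add: eps_def rel_trace_in \<gamma>_in flip: sign_char_add)
qed

lemma eps_eq_iff:
  assumes "w \<in> K" "v \<in> K"
  shows "eps w v = eps v w \<longleftrightarrow> sign_char m (w * v ^ 2 ^ m + v * w ^ 2 ^ m) = 1"
  unfolding eps_swap[OF assms, symmetric] by (simp add: eps_def sign_char_def)

text \<open>Every \<open>w\<close> is \<open>coord_a w + \<gamma> * coord_b w\<close> with both coordinates in \<open>F\<close>.\<close>

definition coord_b :: "F2bar \<Rightarrow> F2bar" where
  "coord_b w = rel_trace m w"

definition coord_a :: "F2bar \<Rightarrow> F2bar" where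
  "coord_a w = w + \<gamma> * rel_trace m w"

lemma coord_b_in: "w \<in> K \<Longrightarrow> coord_b w \<in> F"
  by (simp add: coord_b_def rel_trace_in)

lemma coord_a_in:
  assumes "w \<in> K"
  shows "coord_a w \<in> F"
proof -
  have "rel_trace m w ^ 2 ^ m = rel_trace m w" using rel_trace_in[OF assms] by (simp add: GF2_def)
  \<comment> \<open>With t = w + w^q, conjugation gives w^q + (gamma + 1) t, which equals w + gamma
    t again.\<close>
  then show ?thesis
    by (simp add: coord_a_def GF2_def frobenius_add power_mult_distrib \<gamma> algebra_simps)
      (simp add: rel_trace_def ac_simps)
qed

lemma coord_add:
  "coord_a (w + v) = coord_a w + coord_a v" "coord_b (w + v) = coord_b w + coord_b v"
  by (simp_all add: coord_a_def coord_b_def rel_trace_add algebra_simps)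

lemma coord_0 [simp]: "coord_a 0 = 0" "coord_b 0 = 0"
  by (simp_all add: coord_a_def coord_b_def rel_trace_def power_0_left)

lemma coord_eq_0: "coord_a w = 0 \<Longrightarrow> coord_b w = 0 \<Longrightarrow> w = 0"
  by (simp add: coord_a_def coord_b_def)

lemma coord_combination:
  assumes "a \<in> F" "b \<in> F"
  shows "a + \<gamma> * b \<in> K" "coord_a (a + \<gamma> * b) = a" "coord_b (a + \<gamma> * b) = b"
proof -
  show "a + \<gamma> * b \<in> K" using assms \<gamma>_in by (simp add: GF2_double)
  have "rel_trace m (\<gamma> * b) = b"
    using assms(2) by (simp add: rel_trace_def GF2_def power_mult_distrib \<gamma> algebra_simps)
  then have "rel_trace m (a + \<gamma> * b) = b"
    using assms(1) rel_trace_eq_0[of m a] by (simp add: rel_trace_add)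
  then show "coord_b (a + \<gamma> * b) = b" "coord_a (a + \<gamma> * b) = a"
    by (simp_all add: coord_a_def coord_b_def ac_simps)
qed

text \<open>The sign produced when the diagonal factor of w is moved past the shift of v.\<close>

definition eps0 :: "F2bar \<Rightarrow> F2bar \<Rightarrow> complex" where
  "eps0 w v = sign_char m (coord_b w * coord_a v)"

text \<open>Both cocycles have the same commutator pairing, so their ratio is symmetric and can be
  removed by rescaling the basis.\<close>

lemma eps0_swap:
  assumes "w \<in> K" "v \<in> K"
  shows "eps0 w v * eps0 v w = eps w v * eps v w"
proof -
  have "eps0 w v * eps0 v w = sign_char m (coord_b w * coord_a v + coord_b v * coord_a w)"
    using assms by (simp add: eps0_def coord_b_in coord_a_in sign_char_add)
  also have "coord_b w * coord_a v + coord_b v * coord_a w = w * v ^ 2 ^ m + v * w ^ 2 ^ m"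
    by (simp add: coord_a_def coord_b_def rel_trace_def algebra_simps)
  finally show ?thesis using eps_swap[OF assms] by simp
qed

text \<open>Shift by \<open>coord_a w\<close> composed with the diagonal matrix of the character \<open>coord_b w\<close>; \<open>e\<close> labels
  the rows and columns by the elements of \<open>F\<close>.\<close>

definition weyl :: "('n \<Rightarrow> F2bar) \<Rightarrow> F2bar \<Rightarrow> complex^'n^'n" where
  "weyl e w = (\<chi> x y. if e x = e y + coord_a w then sign_char m (coord_b w * e y) else 0)"

lemma weyl_mult:
  fixes e :: "'n::finite \<Rightarrow> F2bar"
  assumes e: "bij_betw e UNIV F" and w: "w \<in> K" and v: "v \<in> K"
  shows "weyl e w ** weyl e v = mat_scale (eps0 w v) (weyl e (w + v))"
proof -
  have eF: "e x \<in> F" for x using e by (auto simp: bij_betw_def)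
  have "(\<Sum>z\<in>UNIV. weyl e w $ x $ z * weyl e v $ z $ y) = eps0 w v * weyl e (w + v) $ x $ y" for x y
  proof -
    \<comment> \<open>Column y of the second matrix has one nonzero entry, in the row z0 that the
      shift assigns to y.\<close>
    have "e y + coord_a v \<in> e ` UNIV" using e eF coord_a_in[OF v] by (simp add: bij_betw_def)
    then obtain z0 where z0: "e z0 = e y + coord_a v" by auto
    have z0_iff: "e z = e y + coord_a v \<longleftrightarrow> z = z0" for z
      using e z0 by (metis bij_betw_imp_inj_on injD)
    have "(\<Sum>z\<in>UNIV. weyl e w $ x $ z * weyl e v $ z $ y) =
        (\<Sum>z\<in>UNIV. if z = z0 then weyl e w $ x $ z * sign_char m (coord_b v * e y) else 0)"
      by (intro sum.cong) (auto simp: weyl_def z0_iff)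
    also have "\<dots> = weyl e w $ x $ z0 * sign_char m (coord_b v * e y)" by simp
    also have "\<dots> = eps0 w v * weyl e (w + v) $ x $ y"
      using eF w v
      by (simp add: weyl_def z0 eps0_def coord_add coord_b_in coord_a_in distrib_left distrib_right
          sign_char_add ac_simps)
    finally show ?thesis .
  qed
  then show ?thesis by (simp add: matrix_matrix_mult_def mat_scale_def vec_eq_iff)
qed

lemma weyl_0:
  assumes "inj e"
  shows "weyl e 0 = mat 1"
  using assms by (auto simp: weyl_def mat_def vec_eq_iff dest: injD)

text \<open>A nonzero shift leaves the diagonal empty; without a shift the diagonal lists a
  nontrivial character, which sums to 0 over F.\<close>

lemma trace_weyl:
  assumes e: "bij_betw e UNIV F" and w: "w \<in> K" "w \<noteq> 0"
  shows "trace (weyl e w) = 0"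
proof (cases "coord_a w = 0")
  case True
  then have "coord_b w \<noteq> 0" using w coord_eq_0 by blast
  have "trace (weyl e w) = (\<Sum>x\<in>UNIV. sign_char m (coord_b w * e x))"
    using True by (simp add: trace_def weyl_def)
  also have "\<dots> = (\<Sum>y\<in>F. sign_char m (coord_b w * y))"
    by (rule sum.reindex_bij_betw[OF e])
  also have "\<dots> = 0" using sum_sign_char[OF m coord_b_in[OF w(1)]] \<open>coord_b w \<noteq> 0\<close> by simp
  finally show ?thesis .
next
  case False
  then show ?thesis by (simp add: trace_def weyl_def)
qed

text \<open>Fourier inversion: averaging over the diagonal characters, weighted by their values at
  \<open>e y0\<close>, isolates column y0, and the shift by \<open>e x0 + e y0\<close> puts the
  entry into row x0.\<close>

lemma matrix_unit_weyl:
  assumes e: "bij_betw e UNIV F"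
  shows "(\<chi> x y. if x = x0 \<and> y = y0 then 1 else 0) =
    mat_scale (1 / 2 ^ m)
      (\<Sum>b\<in>F. mat_scale (sign_char m (b * e y0)) (weyl e ((e x0 + e y0) + \<gamma> * b)))"
proof -
  have eF: "e x \<in> F" for x using e by (auto simp: bij_betw_def)
  have e_iff: "e x = e y \<longleftrightarrow> x = y" for x y
    using e by (auto simp: bij_betw_def dest: injD)
  have entry: "(\<Sum>b\<in>F. mat_scale (sign_char m (b * e y0)) (weyl e ((e x0 + e y0) + \<gamma> * b))) $ x $ y =
      (if x = x0 \<and> y = y0 then 2 ^ m else 0)" for x y
  proof -
    have "(\<Sum>b\<in>F. mat_scale (sign_char m (b * e y0)) (weyl e ((e x0 + e y0) + \<gamma> * b))) $ x $ y =
        (\<Sum>b\<in>F. if e x = e y + (e x0 + e y0) then sign_char m ((e y0 + e y) * b) else 0)"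
    proof -
      have "(mat_scale (sign_char m (b * e y0)) (weyl e ((e x0 + e y0) + \<gamma> * b))) $ x $ y =
          (if e x = e y + (e x0 + e y0) then sign_char m ((e y0 + e y) * b) else 0)" if "b \<in> F" for b
        using eF that coord_combination[of "e x0 + e y0" b]
        by (simp add: mat_scale_def weyl_def distrib_right sign_char_add mult.commute[of b])
      then show ?thesis by (simp add: sum_component)
    qed
    also have "\<dots> = (if e x = e y + (e x0 + e y0) \<and> e y0 + e y = 0 then 2 ^ m else 0)"
      using sum_sign_char[OF m, of "e y0 + e y"] eF
      by (cases "e x = e y + (e x0 + e y0)") simp_all
    also have "\<dots> = (if x = x0 \<and> y = y0 then 2 ^ m else 0)"
      by (auto simp: add_eq_0_F2bar two_eq_0_F2bar e_iff add.left_commute[of "e y0"])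
    finally show ?thesis .
  qed
  show ?thesis by (simp add: vec_eq_iff mat_scale_def[of "1 / 2 ^ m"] entry del: sum_component)
qed

lemma span_weyl:
  fixes e :: "'n::finite \<Rightarrow> F2bar"
  assumes e: "bij_betw e UNIV F"
  shows "mat_space.span (weyl e ` K) = UNIV"
proof -
  have eF: "e x \<in> F" for x using e by (auto simp: bij_betw_def)
  have unit: "(\<chi> x y. if x = x0 \<and> y = y0 then 1 else 0) \<in> mat_space.span (weyl e ` K)" for x0 y0
    unfolding matrix_unit_weyl[OF e] using eF
    by (intro mat_space.span_scale mat_space.span_sum mat_space.span_base imageI coord_combination) simp_all
  have "A \<in> mat_space.span (weyl e ` K)" for A :: "complex^'n^'n"
  proof -
    have "A = (\<Sum>x0\<in>UNIV. \<Sum>y0\<in>UNIV. mat_scale (A $ x0 $ y0) (\<chi> x y. if x = x0 \<and> y = y0 then 1 else 0))"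
    proof -
      have "(\<Sum>y0\<in>UNIV. A $ x0 $ y0 * (if x = x0 \<and> y = y0 then 1 else 0)) = (if x = x0 then A $ x $ y else 0)"
        for x0 x y
        by (cases "x = x0") (simp_all add: if_distrib[of "\<lambda>z. _ * z"] cong: if_cong)
      then show ?thesis by (simp add: vec_eq_iff mat_scale_def)
    qed
    also have "\<dots> \<in> mat_space.span (weyl e ` K)"
      by (intro mat_space.span_sum mat_space.span_scale unit)
    finally show ?thesis .
  qed
  then show ?thesis by blast
qed

lemma twisted_basis_exists:
  assumes "CARD('n::finite) = 2 ^ m"
  shows "\<exists>P :: F2bar \<Rightarrow> complex^'n^'n. twisted_basis K eps P"
proof -
  have "card (UNIV :: 'n set) = card F" using assms finite_card_GF2[OF m] by simp
  then obtain e :: "'n \<Rightarrow> F2bar" where e: "bij_betw e UNIV F"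
    using finite_same_card_bij[OF finite finite_card_GF2(1)[OF m]] by blast
  have inj: "inj e" using e by (simp add: bij_betw_def)
  have sq: "eps w v * eps w v = 1" "eps0 w v * eps0 w v = 1" for w v
    by (simp_all add: eps_def eps0_def)
  \<comment> \<open>The values are signs, so this product is the ratio of the two cocycles.\<close>
  define c where "c w v = eps w v * eps0 w v" for w v
  have c_sq: "c w v * c w v = 1" for w v
    using sq[of w v] by (simp add: c_def mult_ac)
  have finK: "finite K" using finite_card_GF2(1)[of "2 * m"] m by simp
  have "\<exists>t. (\<forall>w\<in>K. t w \<noteq> 0) \<and> (\<forall>w\<in>K. \<forall>v\<in>K. t (w + v) = t w * t v * c w v)"
  proof (rule quadratic_refinement)
    show "c w v \<noteq> 0" for w v by (simp add: c_def eps_def eps0_def)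
    show "c (w + v) u = c w u * c v u" if "w \<in> K" "v \<in> K" "u \<in> K" for w v u
      using that by (simp add: c_def eps_add_left eps0_def coord_add distrib_right sign_char_add
          coord_b_in coord_a_in)
    show "c w v = c v w" if "w \<in> K" "v \<in> K" for w v
    proof -
      have "c w v * c v w = (eps w v * eps v w) * (eps0 w v * eps0 v w)" by (simp add: c_def)
      also have "\<dots> = 1"
        unfolding eps0_swap[OF that] eps_swap[OF that] by simp
      finally show ?thesis using c_sq[of v w] by (metis mult_cancel_right mult_zero_right zero_neq_one)
    qed
  qed (use finK in simp_all)
  then obtain t where t_nz: "\<And>w. w \<in> K \<Longrightarrow> t w \<noteq> 0"
    and t: "\<And>w v. w \<in> K \<Longrightarrow> v \<in> K \<Longrightarrow> t (w + v) = t w * t v * c w v" by metis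
  define P :: "F2bar \<Rightarrow> complex^'n^'n" where "P w = mat_scale (t w) (weyl e w)" for w
  have "twisted_basis K eps P"
  proof
    show "finite K" by (rule finK)
    show "eps w v \<noteq> 0" for w v by (simp add: eps_def)
    show "P w ** P v = mat_scale (eps w v) (P (w + v))" if "w \<in> K" "v \<in> K" for w v
    proof -
      have "eps w v * t (w + v) = t w * t v * eps0 w v * (eps w v * eps w v)"
        using that by (simp add: t c_def)
      then show ?thesis
        using that sq(1) by (simp add: P_def mat_scale_mult weyl_mult[OF e] mult_ac)
    qed
    have "t 0 * t 0 = t 0 * 1"
      using t[of 0 0] by (simp add: c_def eps_def eps0_def rel_trace_def power_0_left)
    then have "t 0 = 1" using t_nz[of 0] by simp
    then show "P 0 = mat 1" by (simp add: P_def weyl_0[OF inj])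
    show "trace (P w) = 0" if "w \<in> K" "w \<noteq> 0" for w
      using that by (simp add: P_def trace_mat_scale trace_weyl[OF e])
    have "weyl e w \<in> mat_space.span (P ` K)" if "w \<in> K" for w
    proof -
      have "weyl e w = mat_scale (1 / t w) (P w)" using t_nz[OF that] by (simp add: P_def)
      then show ?thesis using that by (simp add: mat_space.span_scale mat_space.span_base)
    qed
    then have "mat_space.span (weyl e ` K) \<subseteq> mat_space.span (P ` K)"
      by (intro mat_space.span_minimal) auto
    then show "mat_space.span (P ` K) = UNIV" using span_weyl[OF e] by auto
  qed simp_all
  then show ?thesis by blast
qed

end

section \<open>The q + 1 lines of the plane K over F and their rotation\<close>

theorem theorem3:
  fixes m q :: nat
  assumes "m \<ge> 1" and "q = 2 ^ m" and "CARD('n::finite) = q"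
  shows "\<exists>(H :: nat \<Rightarrow> (complex^'n^'n) set) \<phi>.
      (\<forall>i\<in>{1..q + 1}. sl.cartan_subalgebra (H i)) \<and>
      sl.direct_sum_decomp {1..q + 1} H \<and>
      (\<forall>i\<in>{1..q + 1}. \<forall>j\<in>{1..q + 1}. i \<noteq> j \<longrightarrow> sl.killing_orthogonal (H i) (H j)) \<and>
      \<phi> \<in> carrier sl.lie_aut_group \<and>
      group.ord sl.lie_aut_group \<phi> = q + 1 \<and>
      transitive_action (subgroup_generated sl.lie_aut_group {\<phi>}) (H ` {1..q + 1})
        (\<lambda>g. \<lambda>X\<in>H ` {1..q + 1}. g ` X)"
proof -
  have m: "m > 0" using assms(1) by simp
  obtain \<gamma> :: F2bar where \<gamma>: "\<gamma> ^ 2 ^ m = \<gamma> + 1" using artin_schreier_root[OF m] by blast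
  interpret quadratic_extension m \<gamma> using m \<gamma> by unfold_locales
  obtain P :: "F2bar \<Rightarrow> complex^'n^'n" where "twisted_basis K eps P"
    using twisted_basis_exists assms by blast
  then interpret twisted_basis K eps P .
  obtain \<zeta> :: F2bar where \<zeta>: "\<And>z. z ^ (q + 1) = 1 \<longleftrightarrow> (\<exists>k::nat. z = \<zeta> ^ k)"
    and \<zeta>_ord: "\<And>n. \<zeta> ^ n = 1 \<longleftrightarrow> (q + 1) dvd n"
    using cyclic_norm_one[OF m] unfolding assms(2) by blast
  have \<zeta>1: "\<zeta> ^ (q + 1) = 1" by (simp only: \<zeta>_ord dvd_refl)
  \<comment> \<open>An inverse square root of \<open>\<zeta>\<close>: twice the exponent is q, and
    zeta^q is the inverse of zeta. Hence xi^(q-1) = xi^(-2) = zeta, and multiplication by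
    \<open>\<xi>\<close> raises the index of the lines \<open>L i\<close> below by exactly
    one.\<close>
  define \<xi> where "\<xi> = \<zeta> ^ (2 ^ (m - 1))"
  have q2: "q = 2 * 2 ^ (m - 1)" using m assms(2) by (cases m) simp_all
  have \<xi>1: "\<xi> ^ (q + 1) = 1" unfolding \<zeta> \<xi>_def by (rule exI, rule refl)
  then have \<xi>0: "\<xi> \<noteq> 0" by auto
  have \<xi>\<xi>: "\<zeta> * (\<xi> * \<xi>) = 1"
  proof -
    have "\<xi> * \<xi> = \<zeta> ^ q" unfolding \<xi>_def q2 by (simp add: mult_2 power_add)
    then show ?thesis using \<zeta>1 by simp
  qed
  have \<xi>q: "\<xi> ^ q = \<zeta> * \<xi>"
    using \<xi>1 \<xi>\<xi> \<xi>0 by (metis Suc_eq_plus1 mult.assoc mult_cancel_right power_Suc2)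
  have \<xi>_ord: "\<xi> ^ n = 1 \<longleftrightarrow> (q + 1) dvd n" for n
  proof
    assume "\<xi> ^ n = 1"
    moreover have "\<zeta> ^ n * (\<xi> ^ n * \<xi> ^ n) = 1"
      unfolding power_mult_distrib[symmetric] \<xi>\<xi> by simp
    ultimately show "(q + 1) dvd n" using \<zeta>_ord by simp
  next
    assume "(q + 1) dvd n"
    then show "\<xi> ^ n = 1" using \<xi>1 by (metis dvdE power_mult power_one)
  qed
  have \<xi>K: "\<xi> \<in> K"
  proof -
    have "(\<xi> ^ q) ^ q * \<xi> ^ q = \<xi> * \<xi> ^ q"
      using \<xi>1 by (metis Suc_eq_plus1 mult.commute power_Suc2 power_mult power_one)
    then have "(\<xi> ^ q) ^ q = \<xi>" using \<xi>0 by simp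
    then show ?thesis by (simp add: GF2_def assms(2) mult_2 power_add flip: power_mult)
  qed
  define \<sigma> where "\<sigma> = (\<lambda>w. \<xi> * w)"
  have \<sigma>_pow: "(\<sigma> ^^ n) w = \<xi> ^ n * w" for n w
    by (induction n) (simp_all add: \<sigma>_def)
  have \<sigma>: "symmetry \<sigma>"
    unfolding symmetry_def
  proof (intro conjI ballI)
    show "bij_betw \<sigma> K K"
      using \<xi>K \<xi>0 by (intro bij_betwI[of _ _ _ "\<lambda>w. inverse \<xi> * w"])
        (auto simp: \<sigma>_def simp flip: mult.assoc)
    show "eps (\<sigma> w) (\<sigma> v) = eps w v" for w v
    proof -
      have "\<gamma> * (\<xi> * w) * (\<xi> * v) ^ 2 ^ m = \<xi> ^ (q + 1) * (\<gamma> * w * v ^ 2 ^ m)"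
        by (simp add: power_mult_distrib assms(2) mult_ac)
      then show ?thesis by (simp only: eps_def \<sigma>_def \<xi>1 mult_1_left)
    qed
  qed (simp add: \<sigma>_def distrib_left)
  have ord: "(\<forall>w\<in>K. (\<sigma> ^^ n) w = w) \<longleftrightarrow> (q + 1) dvd n" for n
    unfolding \<sigma>_pow \<xi>_ord[symmetric] by (auto dest: bspec[of _ _ 1])
  \<comment> \<open>For nonzero w in K, w^q / w is a (q+1)-th root of unity depending only on the
    F-line through w; its value zeta^i labels that line, with i read modulo q + 1.\<close>
  define L where "L i = {w \<in> K. w ^ 2 ^ m = \<zeta> ^ i * w}" for i :: nat
  have LK: "L i \<subseteq> K" for i by (auto simp: L_def)
  have step: "L (Suc i) = \<sigma> ` L i" for i
  proof (intro equalityI subsetI)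
    fix w assume w: "w \<in> L (Suc i)"
    let ?v = "inverse \<xi> * w"
    have wv: "w = \<xi> * ?v" using \<xi>0 by simp
    have "(\<xi> * ?v) ^ q = \<zeta> ^ Suc i * (\<xi> * ?v)"
      using w unfolding wv[symmetric] by (simp add: L_def assms(2))
    then have "(\<zeta> * \<xi>) * ?v ^ q = (\<zeta> * \<xi>) * (\<zeta> ^ i * ?v)"
      unfolding power_mult_distrib \<xi>q power_Suc by (simp only: mult_ac)
    moreover have "\<zeta> * \<xi> \<noteq> 0" using \<xi>\<xi> by auto
    ultimately have "?v ^ q = \<zeta> ^ i * ?v" by (metis mult_left_cancel)
    then have "?v \<in> L i" using w \<xi>K by (simp add: L_def assms(2))
    then show "w \<in> \<sigma> ` L i" using \<xi>0 by (intro image_eqI[of _ _ ?v]) (simp_all add: \<sigma>_def)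
  next
    fix w assume "w \<in> \<sigma> ` L i"
    then show "w \<in> L (Suc i)"
      using \<xi>K \<xi>q by (auto simp: L_def \<sigma>_def assms(2) power_mult_distrib mult_ac)
  qed
  have iso: "eps w v = eps v w" if "w \<in> L i" "v \<in> L i" for w v i
  proof -
    \<comment> \<open>Conjugation multiplies w and v by the same scalar, so the two terms of the
      symplectic form coincide and cancel.\<close>
    have q: "w ^ 2 ^ m = \<zeta> ^ i * w" "v ^ 2 ^ m = \<zeta> ^ i * v" using that by (simp_all add: L_def)
    have "w * v ^ 2 ^ m + v * w ^ 2 ^ m = 0" unfolding q by (simp add: mult_ac)
    then show ?thesis using that LK by (subst eps_eq_iff) auto
  qed
  have \<xi>L: "\<xi> ^ i \<in> L i" for i
  proof (induction i)
    case 0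
    show ?case by (simp add: L_def)
  next
    case (Suc i)
    then show ?case unfolding step by (auto simp: \<sigma>_def)
  qed
  have max: "\<exists>w\<in>L i. w \<noteq> 0 \<and> eps u w \<noteq> eps w u" if u: "u \<in> K - L i" for u i
  proof -
    let ?x = "\<xi> ^ i"
    have x: "?x \<in> K" "?x ^ 2 ^ m = \<zeta> ^ i * ?x" using \<xi>L[of i] by (auto simp: L_def)
    \<comment> \<open>The symplectic pairing of u with xi^i, a generator of the line
      \<open>L i\<close>.\<close>
    define d where "d = rel_trace m (u * ?x ^ 2 ^ m)"
    have d_eq: "d = u * ?x ^ 2 ^ m + ?x * u ^ 2 ^ m"
      using frobenius_twice[OF x(1)] by (simp add: d_def rel_trace_def power_mult_distrib mult.commute)
    have "d \<in> F" unfolding d_def using u x(1) by (intro rel_trace_in) simp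
    \<comment> \<open>The second factor vanishes exactly when u lies in \<open>L i\<close>. With d
      nonzero, an F-multiple of the generator can be chosen whose pairing with u has sign
      -1.\<close>
    moreover have "d = ?x * (\<zeta> ^ i * u + u ^ 2 ^ m)"
      unfolding d_eq x(2) by (simp add: algebra_simps)
    then have "d \<noteq> 0" using u \<xi>0 by (auto simp: L_def add_eq_0_F2bar)
    ultimately obtain f where f: "f \<in> F" "sign_char m (d * f) = -1"
      using sign_char_nontrivial[OF m] by blast
    let ?w = "f * ?x"
    have fq: "f ^ 2 ^ m = f" using f by (simp add: GF2_def)
    have w: "?w \<in> L i" using f x fq by (simp add: L_def GF2_double power_mult_distrib)
    have "u * ?w ^ 2 ^ m + ?w * u ^ 2 ^ m = d * f"
      unfolding d_eq power_mult_distrib fq by (simp add: algebra_simps)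
    then have "eps u ?w \<noteq> eps ?w u" using u w LK f by (subst eps_eq_iff) auto
    moreover have "?w \<noteq> 0" using f \<xi>0 by auto
    ultimately show ?thesis using w by blast
  qed
  have L_eq: "i = j" if "w \<in> L i" "w \<in> L j" "w \<noteq> 0" "i \<in> {1..q + 1}" "j \<in> {1..q + 1}" for w i j
  proof -
    have eq: "\<zeta> ^ i = \<zeta> ^ j" using that by (auto simp: L_def)
    have "\<zeta> \<noteq> 0" using \<zeta>1 by auto
    have "k = l" if "\<zeta> ^ k = \<zeta> ^ l" "k \<le> l" "k \<ge> 1" "l \<le> q + 1" for k l
    proof -
      have "\<zeta> ^ k * \<zeta> ^ (l - k) = \<zeta> ^ l" using that(2) by (simp flip: power_add)
      then have "\<zeta> ^ k * \<zeta> ^ (l - k) = \<zeta> ^ k * 1" using that(1) by simp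
      then have "(q + 1) dvd (l - k)" using \<open>\<zeta> \<noteq> 0\<close> \<zeta>_ord by simp
      then show ?thesis using that by (auto dest: dvd_imp_le)
    qed
    from this[of i j] this[of j i] show ?thesis using eq that by force
  qed
  have part: "\<exists>!i. i \<in> {1..q + 1} \<and> w \<in> L i" if w: "w \<in> K - {0}" for w
  proof -
    have wqq: "(w ^ q) ^ q = w" using frobenius_twice[of w m] w assms(2) by simp
    \<comment> \<open>Raising to the power q + 1 gives w^(q^2) / w, which is 1 in K.\<close>
    have "(w ^ q / w) ^ (q + 1) = 1"
      using w by (simp add: power_divide wqq)
    then obtain k where k: "w ^ q / w = \<zeta> ^ k" using \<zeta> by blast
    \<comment> \<open>The exponent congruent to k modulo q + 1 in the range from 1 to q + 1.\<close>
    let ?i = "Suc ((k + q) mod (q + 1))"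
    have "k + (q + 1) = ?i + (q + 1) * ((k + q) div (q + 1))"
      using mod_mult_div_eq[of "k + q" "q + 1"] by simp
    then have "\<zeta> ^ k * \<zeta> ^ (q + 1) = \<zeta> ^ ?i * (\<zeta> ^ (q + 1)) ^ ((k + q) div (q + 1))"
      by (simp only: power_add[symmetric] power_mult[symmetric])
    then have "\<zeta> ^ k = \<zeta> ^ ?i" by (simp only: \<zeta>1 power_one mult_1_right)
    then have "w \<in> L ?i" using k w assms(2) by (auto simp: L_def field_simps)
    moreover have "?i \<in> {1..q + 1}" by (simp add: Suc_le_eq)
    ultimately show ?thesis using L_eq w by blast
  qed
  have add: "w + v \<in> L i" if "w \<in> L i" "v \<in> L i" for w v i
    using that by (auto simp: L_def frobenius_add distrib_left)
  show ?thesis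
  proof (intro exI conjI ballI impI)
    show "sl.cartan_subalgebra (block (L i))" for i
      using LK add iso max by (rule cartan_block)
    show "sl.direct_sum_decomp {1..q + 1} (\<lambda>i. block (L i))"
      using part by (intro direct_sum_blocks) auto
    show "sl.killing_orthogonal (block (L i)) (block (L j))"
      if "i \<in> {1..q + 1}" "j \<in> {1..q + 1}" "i \<noteq> j" for i j
      using that L_eq by (intro killing_orthogonal_block) blast
    show "restrict (permute \<sigma>) sl \<in> carrier sl.lie_aut_group"
      using permute_lie_auts[OF \<sigma>] by (simp add: sl.lie_aut_group_def)
    show "group.ord sl.lie_aut_group (restrict (permute \<sigma>) sl) = q + 1"
      by (rule ord_permute[OF \<sigma> ord])
    show "transitive_action (subgroup_generated sl.lie_aut_group {restrict (permute \<sigma>) sl})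
        ((\<lambda>i. block (L i)) ` {1..q + 1}) (\<lambda>g. \<lambda>X\<in>(\<lambda>i. block (L i)) ` {1..q + 1}. g ` X)"
      by (rule transitive_blocks[OF \<sigma>]) (simp, rule ord, rule LK, rule step)
  qed
qed

end
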